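(* Let $\mathcal{A}^{\mathrm{NIC}}=\{(\mathbf{J}_{\mathbf{V}},\mathrm{vSINR}^{\mathrm{NIC}}_{\mathbf{V}}) : \mathbf{V}\in\mathbb{C}^{N_T\times(N_T+K)},\ \mathrm{tr}(\mathbf{V}\mathbf{V}^{H})\le P\}$ be the set of pairs (Bayesian Fisher information matrix, SINR vector without interference cancellation) achievable with a full set of $N_T+K$ beamformers under power constraint $P$, in an ISAC system sensing $L$ real parameters and serving $K$ users. Put $$N_{\mathrm{bound}}^{\mathrm{NIC}}=\left\lfloor \sqrt{K^2+\tfrac{L(L+1)}{2}}\right\rfloor .$$ Then for every $(\mathbf{J},\boldsymbol{\gamma})\in\mathcal{A}^{\mathrm{NIC}}$ with $\boldsymbol{\gamma}>\mathbf{0}$ (entrywise) there exist an integer $N'$ with $K\le N'\le N_{\mathrm{bound}}^{\mathrm{NIC}}$ and $\mathbf{V}'\in\mathbb{C}^{N_T\times N'}$ such that $$\mathbf{J}_{\mathbf{V}'}=\mathbf{J},\qquad \mathrm{vSINR}^{\mathrm{NIC}}_{\mathbf{V}'}\ge\boldsymbol{\gamma}\ \text{(entrywise)},\qquad \mathrm{tr}(\mathbf{V}'\mathbf{V}'^{H})\le P .$$ Consequently, the minimum number of beamformers satisfies $N_{\min}^{\mathrm{NIC}}\le N_{\mathrm{bound}}^{\mathrm{NIC}}$.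
   Context: Integers $N_T,N_R,L,\Upsilon\ge1$, $K\ge0$; reals $\sigma^2>0$, $P>0$; fixed channel vectors $\mathbf{h}_1,\dots,\mathbf{h}_K\in\mathbb{C}^{N_T}$. Beamformers: for $N\ge K$, a beamforming matrix with $N$ beamformers is $\mathbf{V}=[\mathbf{v}_1,\dots,\mathbf{v}_K,\mathbf{V}_s]\in\mathbb{C}^{N_T\times N}$, with communication beamformers $\mathbf{v}_k\in\mathbb{C}^{N_T}$ and sensing beamformers $\mathbf{V}_s\in\mathbb{C}^{N_T\times(N-K)}$. Bayesian Fisher information matrix (BFIM): $\boldsymbol{\eta}\in\mathbb{R}^L$ is a random parameter vector with prior density $f$, and $\mathbf{G}^{(\boldsymbol{\eta})}\in\mathbb{C}^{N_R\times N_T}$ is a known deterministic differentiable function of $\boldsymbol{\eta}$ (all expectations below are assumed to exist). The BFIM is $\mathbf{J}_{\mathbf{V}}=\mathbf{C}+\mathbf{T}_{\mathbf{V}}\in\mathbb{R}^{L\times L}$, where $[\mathbf{C}]_{ij}=-\mathbb{E}[\partial^2\log f(\boldsymbol{\eta})/\partial\eta_i\partial\eta_j]$ ($\mathbf{C}$ is positive semidefinite and does not depend on $\mathbf{V}$) and $[\mathbf{T}_{\mathbf{V}}]_{ij}=\frac{\Upsilon}{\sigma^2}\mathrm{tr}(\tilde{\mathbf{G}}_{ij}\mathbf{V}\mathbf{V}^{H})$ with $\tilde{\mathbf{G}}_{ij}=\mathbb{E}[\dot{\mathbf{G}}_i^{H}\dot{\mathbf{G}}_j+\dot{\mathbf{G}}_j^{H}\dot{\mathbf{G}}_i]$,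 $\dot{\mathbf{G}}_i=\partial\mathbf{G}^{(\boldsymbol{\eta})}/\partial\eta_i$. SINR without interference cancellation (NIC): $\mathrm{SINR}^{\mathrm{NIC}}_{k,\mathbf{V}}=\dfrac{|\mathbf{h}_k^{H}\mathbf{v}_k|^2}{\sum_{i\ne k}|\mathbf{h}_k^{H}\mathbf{v}_i|^2+\mathbf{h}_k^{H}\mathbf{V}_s\mathbf{V}_s^{H}\mathbf{h}_k+\sigma^2}$, and $\mathrm{vSINR}^{\mathrm{NIC}}_{\mathbf{V}}=(\mathrm{SINR}^{\mathrm{NIC}}_{1,\mathbf{V}},\dots,\mathrm{SINR}^{\mathrm{NIC}}_{K,\mathbf{V}})^{T}$. Minimum number of beamformers: let $h$ be a real function on $L\times L$ positive semidefinite matrices that is nondecreasing in the Loewner order, and let $\gamma_k>0$ be given SINR targets. For $N\ge K$ let $p_N^*$ be the optimal value of: minimize $h(\mathbf{J}_{\mathbf{V}}^{-1})$ over $\mathbf{V}\in\mathbb{C}^{N_T\times N}$ subject to $\mathrm{SINR}^{\mathrm{NIC}}_{k,\mathbf{V}}\ge\gamma_k$ for all $k$ and $\mathrm{tr}(\mathbf{V}\mathbf{V}^{H})\le P$ (the constraints are assumed strictly feasible). $N_{\min}^{\mathrm{NIC}}$ is the smallest $N\ge K$ with $p_N^*=p_{N_T+K}^*$. *)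

theory Defs
  imports "HOL-Probability.Probability" "Jordan_Normal_Form.Schur_Decomposition"
begin

text \<open>
  The number of columns of a beamforming matrix is a quantified natural number, so complex
  matrices are those of \<^theory>\<open>Jordan_Normal_Form.Matrix\<close>, with explicit dimensions and indices
  starting at 0.  Parameter space and Fisher information matrices have the fixed dimension
  \<open>L = CARD('l)\<close> and use the types \<open>real^'l\<close> and \<open>real^'l^'l\<close>.  Below, \<open>$\<close> is the
  component access of \<^const>\<open>vec_index\<close>.
\<close>

no_notation vec_nth (infixl \<open>$\<close> 90)

definition ctrace :: "complex mat \<Rightarrow> complex" where
  "ctrace A = (\<Sum>i<dim_row A. A $$ (i, i))"

definition psd :: "real^'n^'n \<Rightarrow> bool" where
  "psd A \<longleftrightarrow> Finite_Cartesian_Product.transpose A = A \<and> (\<forall>x. 0 \<le> inner x (A *v x))"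

definition loewner_le :: "real^'n^'n \<Rightarrow> real^'n^'n \<Rightarrow> bool" where
  "loewner_le A B \<longleftrightarrow> psd (B - A)"

definition partial_deriv :: "'l \<Rightarrow> (real^'l \<Rightarrow> 'b::real_normed_vector) \<Rightarrow> real^'l \<Rightarrow> 'b" where
  "partial_deriv i g x = vector_derivative (\<lambda>t. g (x + t *\<^sub>R axis i 1)) (at 0)"

definition has_partial :: "'l \<Rightarrow> (real^'l \<Rightarrow> 'b::real_normed_vector) \<Rightarrow> real^'l \<Rightarrow> bool" where
  "has_partial i g x \<longleftrightarrow> (\<lambda>t. g (x + t *\<^sub>R axis i 1)) differentiable (at 0)"


subsection \<open>Bayesian Fisher information matrix\<close>

text \<open>All second-order partial derivatives of \<open>log f\<close> exist at \<open>x\<close>.  Positivity of \<open>f\<close> near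
  \<open>x\<close> is needed because \<open>ln\<close> is total.\<close>

definition log_twice_partial_differentiable :: "(real^'l \<Rightarrow> real) \<Rightarrow> real^'l \<Rightarrow> bool" where
  "log_twice_partial_differentiable f x \<longleftrightarrow>
     (\<forall>\<^sub>F y in nhds x. 0 < f y \<and> (\<forall>j. has_partial j (\<lambda>z. ln (f z)) y)) \<and>
     (\<forall>i j. has_partial i (partial_deriv j (\<lambda>z. ln (f z))) x)"

definition log_hessian :: "(real^'l \<Rightarrow> real) \<Rightarrow> 'l \<Rightarrow> 'l \<Rightarrow> real^'l \<Rightarrow> real" where
  "log_hessian f i j = partial_deriv i (partial_deriv j (\<lambda>z. ln (f z)))"

definition prior_info :: "'w measure \<Rightarrow> ('w \<Rightarrow> real^'l) \<Rightarrow> (real^'l \<Rightarrow> real) \<Rightarrow> real^'l^'l" where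
  "prior_info M \<eta> f = (\<chi> i j. - (\<integral>\<omega>. log_hessian f i j (\<eta> \<omega>) \<partial>M))"

definition G_dot :: "nat \<Rightarrow> nat \<Rightarrow> (real^'l \<Rightarrow> complex mat) \<Rightarrow> 'l \<Rightarrow> real^'l \<Rightarrow> complex mat" where
  "G_dot NR NT G i x = Matrix.mat NR NT (\<lambda>(r, c). partial_deriv i (\<lambda>y. G y $$ (r, c)) x)"

definition G_cross :: "nat \<Rightarrow> nat \<Rightarrow> (real^'l \<Rightarrow> complex mat) \<Rightarrow> 'l \<Rightarrow> 'l \<Rightarrow> real^'l \<Rightarrow> complex mat" where
  "G_cross NR NT G i j x =
     mat_adjoint (G_dot NR NT G i x) * G_dot NR NT G j x +
     mat_adjoint (G_dot NR NT G j x) * G_dot NR NT G i x"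

definition G_tilde ::
  "'w measure \<Rightarrow> ('w \<Rightarrow> real^'l) \<Rightarrow> nat \<Rightarrow> nat \<Rightarrow> (real^'l \<Rightarrow> complex mat) \<Rightarrow> 'l \<Rightarrow> 'l \<Rightarrow> complex mat" where
  "G_tilde M \<eta> NR NT G i j =
     Matrix.mat NT NT (\<lambda>(a, b). \<integral>\<omega>. G_cross NR NT G i j (\<eta> \<omega>) $$ (a, b) \<partial>M)"

text \<open>Both \<open>G_tilde\<close> and \<open>V V\<^sup>H\<close> are Hermitian, so the trace is real and \<^const>\<open>Re\<close> only changes
  its type.  The same holds for the other uses of \<^const>\<open>Re\<close> below.\<close>

definition data_info ::
  "'w measure \<Rightarrow> ('w \<Rightarrow> real^'l) \<Rightarrow> nat \<Rightarrow> nat \<Rightarrow> (real^'l \<Rightarrow> complex mat) \<Rightarrow> nat \<Rightarrow> real \<Rightarrow>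
   complex mat \<Rightarrow> real^'l^'l" where
  "data_info M \<eta> NR NT G \<Upsilon> \<sigma>2 V =
     (\<chi> i j. real \<Upsilon> / \<sigma>2 * Re (ctrace (G_tilde M \<eta> NR NT G i j * (V * mat_adjoint V))))"

definition bfim ::
  "'w measure \<Rightarrow> ('w \<Rightarrow> real^'l) \<Rightarrow> (real^'l \<Rightarrow> real) \<Rightarrow> nat \<Rightarrow> nat \<Rightarrow> (real^'l \<Rightarrow> complex mat) \<Rightarrow>
   nat \<Rightarrow> real \<Rightarrow> complex mat \<Rightarrow> real^'l^'l" where
  "bfim M \<eta> f NR NT G \<Upsilon> \<sigma>2 V = prior_info M \<eta> f + data_info M \<eta> NR NT G \<Upsilon> \<sigma>2 V"


subsection \<open>Power and SINR\<close>

definition tx_power :: "complex mat \<Rightarrow> real" where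
  "tx_power V = Re (ctrace (V * mat_adjoint V))"

text \<open>Columns \<open>0, \<dots>, K - 1\<close> of \<open>V\<close> are the communication beamformers, the remaining ones form
  \<open>V\<^sub>s\<close>.  Note that \<open>v \<bullet>c h\<close> conjugates its second argument, i.e. \<open>v \<bullet>c h = h\<^sup>H v\<close>.\<close>

definition sensing_part :: "nat \<Rightarrow> complex mat \<Rightarrow> complex mat" where
  "sensing_part K V = Matrix.mat (dim_row V) (dim_col V - K) (\<lambda>(r, c). V $$ (r, c + K))"

definition sinr_NIC ::
  "nat \<Rightarrow> real \<Rightarrow> (nat \<Rightarrow> complex Matrix.vec) \<Rightarrow> complex mat \<Rightarrow> nat \<Rightarrow> real" where
  "sinr_NIC K \<sigma>2 h V k =
     (cmod (col V k \<bullet>c h k))\<^sup>2 /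
     ((\<Sum>i\<in>{..<K} - {k}. (cmod (col V i \<bullet>c h k))\<^sup>2) +
      Re (((sensing_part K V * mat_adjoint (sensing_part K V)) *\<^sub>v h k) \<bullet>c h k) + \<sigma>2)"

definition vsinr_NIC ::
  "nat \<Rightarrow> real \<Rightarrow> (nat \<Rightarrow> complex Matrix.vec) \<Rightarrow> complex mat \<Rightarrow> real Matrix.vec" where
  "vsinr_NIC K \<sigma>2 h V = Matrix.vec K (sinr_NIC K \<sigma>2 h V)"


subsection \<open>Achievable pairs and the minimum number of beamformers\<close>

text \<open>In what follows \<open>J\<close> is the map sending a beamforming matrix to its information matrix.\<close>

definition achievable_NIC ::
  "(complex mat \<Rightarrow> real^'l^'l) \<Rightarrow> nat \<Rightarrow> nat \<Rightarrow> real \<Rightarrow> (nat \<Rightarrow> complex Matrix.vec) \<Rightarrow> real \<Rightarrow>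
   ((real^'l^'l) \<times> real Matrix.vec) set" where
  "achievable_NIC J NT K \<sigma>2 h P =
     {(J V, vsinr_NIC K \<sigma>2 h V) |V. V \<in> carrier_mat NT (NT + K) \<and> tx_power V \<le> P}"

definition N_bound_NIC :: "nat \<Rightarrow> nat \<Rightarrow> nat" where
  "N_bound_NIC K L = nat \<lfloor>sqrt (real K ^ 2 + real L * (real L + 1) / 2)\<rfloor>"

definition feasible_NIC ::
  "nat \<Rightarrow> nat \<Rightarrow> real \<Rightarrow> (nat \<Rightarrow> complex Matrix.vec) \<Rightarrow> real \<Rightarrow> real Matrix.vec \<Rightarrow> nat \<Rightarrow>
   complex mat set" where
  "feasible_NIC NT K \<sigma>2 h P \<gamma> N =
     {V \<in> carrier_mat NT N. (\<forall>k<K. \<gamma> $ k \<le> sinr_NIC K \<sigma>2 h V k) \<and> tx_power V \<le> P}"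

definition strictly_feasible_NIC ::
  "nat \<Rightarrow> nat \<Rightarrow> real \<Rightarrow> (nat \<Rightarrow> complex Matrix.vec) \<Rightarrow> real \<Rightarrow> real Matrix.vec \<Rightarrow> nat \<Rightarrow> bool" where
  "strictly_feasible_NIC NT K \<sigma>2 h P \<gamma> N \<longleftrightarrow>
     (\<exists>V \<in> carrier_mat NT N. (\<forall>k<K. \<gamma> $ k < sinr_NIC K \<sigma>2 h V k) \<and> tx_power V < P)"

text \<open>The objective \<open>\<phi> (J V)\<^sup>-\<^sup>1\<close> is only defined where \<open>J V\<close> is invertible; other \<open>V\<close>
  count as having objective value \<open>\<infinity>\<close>, hence do not contribute to the infimum.\<close>

definition opt_value_NIC ::
  "(real^'l^'l \<Rightarrow> real) \<Rightarrow> (complex mat \<Rightarrow> real^'l^'l) \<Rightarrow> nat \<Rightarrow> nat \<Rightarrow> real \<Rightarrow>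
   (nat \<Rightarrow> complex Matrix.vec) \<Rightarrow> real \<Rightarrow> real Matrix.vec \<Rightarrow> nat \<Rightarrow> ereal" where
  "opt_value_NIC \<phi> J NT K \<sigma>2 h P \<gamma> N =
     (INF V \<in> {V \<in> feasible_NIC NT K \<sigma>2 h P \<gamma> N. invertible (J V)}. ereal (\<phi> (matrix_inv (J V))))"

definition N_min_NIC ::
  "(real^'l^'l \<Rightarrow> real) \<Rightarrow> (complex mat \<Rightarrow> real^'l^'l) \<Rightarrow> nat \<Rightarrow> nat \<Rightarrow> real \<Rightarrow>
   (nat \<Rightarrow> complex Matrix.vec) \<Rightarrow> real \<Rightarrow> real Matrix.vec \<Rightarrow> nat" where
  "N_min_NIC \<phi> J NT K \<sigma>2 h P \<gamma> =
     (LEAST N. K \<le> N \<and>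
        opt_value_NIC \<phi> J NT K \<sigma>2 h P \<gamma> N = opt_value_NIC \<phi> J NT K \<sigma>2 h P \<gamma> (NT + K))"

end

theory Submission
  imports Defs
begin

text \<open>
  Everything depends on a beamforming matrix \<open>V\<close> only through \<open>V V\<^sup>H\<close> and the useful signals
  \<open>h\<^sub>k\<^sup>H v\<^sub>k\<close>.  Keeping \<open>V V\<^sup>H\<close> and maximizing the useful signals, one may assume that no sensing
  beamformer reaches any user.  If then \<open>N\<^sup>2 > K\<^sup>2 + L (L + 1) / 2\<close>, there is a nonzero Hermitian
  \<open>N \<times> N\<close> matrix \<open>D\<close> with vanishing \<open>K \<times> K\<close> block such that \<open>V (I + t D) V\<^sup>H\<close> has the same
  information matrix as \<open>V V\<^sup>H\<close> for all \<open>t\<close>.  Up to sign, the power does not increase for \<open>t > 0\<close> and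
  \<open>I + t D\<close> becomes singular for some \<open>t > 0\<close> while still positive semidefinite.  Its Cholesky factor
  \<open>X\<close> has a zero column and first \<open>K\<close> rows those of the identity, so \<open>V X\<close> needs one beamformer less
  and has the same SINRs.
\<close>

section \<open>Compactness and homogeneous linear systems\<close>

text \<open>Tychonoff: the set is a product of discs over \<open>I\<close> and of copies of {0}
  elsewhere. Pinning the values outside \<open>I\<close> keeps a set of total functions compact, as
  the two extremal arguments further down require.\<close>

lemma compact_bounded_support:
  fixes r :: "'i \<Rightarrow> real"
  shows "compact {f :: 'i \<Rightarrow> complex. (\<forall>i\<in>I. cmod (f i) \<le> r i) \<and> (\<forall>i. i \<notin> I \<longrightarrow> f i = 0)}"
proof -
  have "compactin (product_topology (\<lambda>_. euclidean) UNIV)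
      (PiE UNIV (\<lambda>i. if i \<in> I then cball (0::complex) (r i) else {0}))"
    by (simp add: compactin_PiE)
  then have "compact (PiE UNIV (\<lambda>i. if i \<in> I then cball (0::complex) (r i) else {0}))"
    by (simp add: euclidean_product_topology)
  also have "PiE UNIV (\<lambda>i. if i \<in> I then cball (0::complex) (r i) else {0}) =
      {f. (\<forall>i\<in>I. cmod (f i) \<le> r i) \<and> (\<forall>i. i \<notin> I \<longrightarrow> f i = 0)}"
    by (auto simp: PiE_UNIV_domain Pi_iff) (metis mem_cball_0 singletonD)+
  finally show ?thesis .
qed

text \<open>Gaussian elimination: an equation with a nonzero coefficient is solved for that unknown.
  This uses up one equation and one unknown, so the strict inequality of cardinalities
  survives.\<close>

lemma underdetermined_system_nontrivial_solution:
  fixes c :: "'e \<Rightarrow> 'i \<Rightarrow> real"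
  assumes "finite E" "finite I" "card E < card I"
  shows "\<exists>x. (\<exists>i\<in>I. x i \<noteq> 0) \<and> (\<forall>i. i \<notin> I \<longrightarrow> x i = 0) \<and> (\<forall>e\<in>E. (\<Sum>i\<in>I. c e i * x i) = 0)"
  using assms
proof (induction E arbitrary: I c rule: finite_induct)
  case empty
  then obtain p where "p \<in> I" by fastforce
  then show ?case by (intro exI[of _ "\<lambda>i. if i = p then 1 else 0"]) auto
next
  case (insert e E)
  show ?case
  proof (cases "\<forall>i\<in>I. c e i = 0")
    case True
    have "card E < card I" using insert by simp
    from insert.IH[OF insert.prems(1) this, of c] True show ?thesis by auto
  next
    case False
    then obtain p where p: "p \<in> I" "c e p \<noteq> 0" by blast
    \<comment> \<open>Coefficients of the other equations after equation \<open>e\<close> has been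
      used to eliminate the unknown \<open>p\<close>.\<close>
    let ?c = "\<lambda>e' i. c e' i - c e' p * c e i / c e p"
    have "card E < card (I - {p})" using insert p by (simp add: card_Diff_singleton)
    from insert.IH[OF _ this, of ?c] insert.prems obtain x where
      x: "\<exists>i\<in>I - {p}. x i \<noteq> 0" "\<forall>i. i \<notin> I - {p} \<longrightarrow> x i = 0"
        "\<forall>e'\<in>E. (\<Sum>i\<in>I - {p}. ?c e' i * x i) = 0" by auto
    define s where "s = (\<Sum>i\<in>I - {p}. c e i * x i)"
    \<comment> \<open>Back substitution: the value at \<open>p\<close> is the one that equation
      \<open>e\<close> dictates.\<close>
    define y where "y = x(p := - s / c e p)"
    have split: "(\<Sum>i\<in>I. c e' i * y i) = c e' p * y p + (\<Sum>i\<in>I - {p}. c e' i * x i)" for e'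
    proof -
      have "(\<Sum>i\<in>I - {p}. c e' i * y i) = (\<Sum>i\<in>I - {p}. c e' i * x i)"
        by (rule sum.cong) (auto simp: y_def)
      then show ?thesis using p insert.prems by (simp add: sum.remove)
    qed
    have 1: "(\<Sum>i\<in>I. c e i * y i) = 0"
      unfolding split by (simp add: y_def s_def p(2))
    have 2: "(\<Sum>i\<in>I. c e' i * y i) = 0" if "e' \<in> E" for e'
    proof -
      have "0 = (\<Sum>i\<in>I - {p}. c e' i * x i - c e' p / c e p * (c e i * x i))"
        using x(3) that by (simp add: algebra_simps)
      also have "\<dots> = (\<Sum>i\<in>I - {p}. c e' i * x i) - c e' p / c e p * s"
        by (simp add: sum_subtractf sum_distrib_left s_def)
      finally show ?thesis unfolding split by (simp add: y_def)
    qed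
    have "\<exists>i\<in>I. y i \<noteq> 0" "\<forall>i. i \<notin> I \<longrightarrow> y i = 0"
      using x(1,2) p by (auto simp: y_def)
    with 1 2 show ?thesis by (intro exI[of _ y]) auto
  qed
qed

subsection \<open>Hermitian forms and Cholesky factorization\<close>

text \<open>The form \<open>z^H \<Phi> z\<close>. The explicit index set lets the elimination below
  drop one index at a time.\<close>

definition qform :: "'i set \<Rightarrow> ('i \<Rightarrow> 'i \<Rightarrow> complex) \<Rightarrow> ('i \<Rightarrow> complex) \<Rightarrow> complex" where
  "qform I \<Phi> z = (\<Sum>i\<in>I. \<Sum>j\<in>I. cnj (z i) * \<Phi> i j * z j)"

definition hermitian_on :: "'i set \<Rightarrow> ('i \<Rightarrow> 'i \<Rightarrow> complex) \<Rightarrow> bool" where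
  "hermitian_on I \<Phi> \<longleftrightarrow> (\<forall>i\<in>I. \<forall>j\<in>I. cnj (\<Phi> i j) = \<Phi> j i)"

lemma qform_cong:
  assumes "\<And>i j. i \<in> I \<Longrightarrow> j \<in> I \<Longrightarrow> \<Phi> i j = \<Psi> i j" "\<And>i. i \<in> I \<Longrightarrow> y i = z i"
  shows "qform I \<Phi> y = qform I \<Psi> z"
  unfolding qform_def by (intro sum.cong refl) (simp add: assms)

lemma cnj_mult_self: "cnj x * x = complex_of_real ((cmod x)\<^sup>2)"
  by (metis complex_norm_square mult.commute of_real_power)

lemma hermitian_onD: "hermitian_on I \<Phi> \<Longrightarrow> i \<in> I \<Longrightarrow> j \<in> I \<Longrightarrow> cnj (\<Phi> i j) = \<Phi> j i"
  by (simp add: hermitian_on_def)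

lemma cnj_qform:
  assumes "hermitian_on I \<Phi>"
  shows "cnj (qform I \<Phi> z) = qform I \<Phi> z"
proof -
  have "cnj (qform I \<Phi> z) = (\<Sum>i\<in>I. \<Sum>j\<in>I. cnj (z j) * \<Phi> j i * z i)"
    unfolding qform_def cnj_sum
    by (intro sum.cong refl) (simp add: hermitian_onD[OF assms])
  also have "\<dots> = qform I \<Phi> z" unfolding qform_def by (rule sum.swap)
  finally show ?thesis .
qed

text \<open>Splits off the pivot \<open>p\<close>: by Hermitian symmetry the two cross terms are
  conjugate, hence add up to twice a real part.\<close>

lemma qform_insert:
  assumes "finite I" "p \<notin> I" "hermitian_on (insert p I) \<Phi>"
  shows "qform (insert p I) \<Phi> z = \<Phi> p p * (cmod (z p))\<^sup>2
     + 2 * Re (cnj (z p) * (\<Sum>j\<in>I. \<Phi> p j * z j)) + qform I \<Phi> z"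
proof -
  let ?b = "\<Sum>j\<in>I. \<Phi> p j * z j"
  have h1: "(\<Sum>i\<in>I. cnj (z i) * \<Phi> i p * z p) = cnj (cnj (z p) * ?b)"
    unfolding complex_cnj_mult cnj_sum sum_distrib_left
    by (intro sum.cong refl) (simp add: hermitian_onD[OF assms(3)])
  have h2: "cnj (z p) * ?b + cnj (cnj (z p) * ?b) = 2 * Re (cnj (z p) * ?b)"
    by (rule complex_add_cnj)
  have h3: "(\<Sum>j\<in>I. cnj (z p) * \<Phi> p j * z j) = cnj (z p) * ?b"
    by (simp add: sum_distrib_left mult.assoc)
  have h4: "cnj (z p) * \<Phi> p p * z p = \<Phi> p p * (cmod (z p))\<^sup>2"
    by (simp only: flip: cnj_mult_self) (simp only: mult_ac)
  have h5: "qform (insert p I) \<Phi> z = cnj (z p) * \<Phi> p p * z p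
     + (\<Sum>j\<in>I. cnj (z p) * \<Phi> p j * z j) + (\<Sum>i\<in>I. cnj (z i) * \<Phi> i p * z p) + qform I \<Phi> z"
    using assms(1,2) unfolding qform_def by (simp add: sum.distrib)
  show ?thesis
    unfolding h5 h4 h3 h1 h2[symmetric] by (simp only: add.assoc)
qed

text \<open>Division by a vanishing pivot gives \<open>0\<close>, which is the right value since the
  pivot row of a positive semidefinite matrix then vanishes.\<close>

definition schur_complement :: "'i \<Rightarrow> ('i \<Rightarrow> 'i \<Rightarrow> complex) \<Rightarrow> 'i \<Rightarrow> 'i \<Rightarrow> complex" where
  "schur_complement p \<Phi> i j = \<Phi> i j - \<Phi> i p * \<Phi> p j / \<Phi> p p"

lemma hermitian_schur_complement:
  assumes "hermitian_on (insert p I) \<Phi>"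
  shows "hermitian_on I (schur_complement p \<Phi>)"
proof -
  have h: "cnj (\<Phi> i j) = \<Phi> j i" if "i \<in> insert p I" "j \<in> insert p I" for i j
    using hermitian_onD[OF assms that] .
  show ?thesis
    by (simp add: hermitian_on_def schur_complement_def h mult.commute)
qed

text \<open>The correction is a rank-one form, because Hermitian symmetry makes the column sum at
  \<open>p\<close> the conjugate of the row sum. For a zero pivot both corrections are 0.\<close>

lemma qform_schur_complement:
  assumes "finite I" "p \<notin> I" "hermitian_on (insert p I) \<Phi>"
  shows "qform I (schur_complement p \<Phi>) z =
    qform I \<Phi> z - complex_of_real ((cmod (\<Sum>j\<in>I. \<Phi> p j * z j))\<^sup>2) / \<Phi> p p"
proof -
  let ?b = "\<Sum>j\<in>I. \<Phi> p j * z j"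
  have "qform I (schur_complement p \<Phi>) z = qform I \<Phi> z -
     (\<Sum>i\<in>I. \<Sum>j\<in>I. (cnj (z i) * \<Phi> i p) * (\<Phi> p j * z j) / \<Phi> p p)"
    by (simp add: qform_def schur_complement_def ring_distribs sum_subtractf mult_ac)
  also have "(\<Sum>i\<in>I. \<Sum>j\<in>I. (cnj (z i) * \<Phi> i p) * (\<Phi> p j * z j) / \<Phi> p p)
     = (\<Sum>i\<in>I. cnj (z i) * \<Phi> i p) * ?b / \<Phi> p p"
    by (simp add: sum_product sum_divide_distrib)
  also have "(\<Sum>i\<in>I. cnj (z i) * \<Phi> i p) = cnj ?b"
    unfolding cnj_sum
    by (intro sum.cong refl) (simp add: hermitian_onD[OF assms(3)])
  also have "cnj ?b * ?b = complex_of_real ((cmod ?b)\<^sup>2)" by (simp add: complex_norm_square mult_ac flip: of_real_power)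
  finally show ?thesis .
qed

lemma qform_complete_square:
  assumes "finite I" "p \<notin> I" "hermitian_on (insert p I) \<Phi>" "\<Phi> p p \<noteq> 0"
  shows "qform (insert p I) \<Phi> z = \<Phi> p p * (cmod (z p + (\<Sum>j\<in>I. \<Phi> p j * z j) / \<Phi> p p))\<^sup>2
     + qform I (schur_complement p \<Phi>) z"
proof -
  let ?b = "\<Sum>j\<in>I. \<Phi> p j * z j"
  have "cnj (\<Phi> p p) = \<Phi> p p" using hermitian_onD[OF assms(3), of p p] by blast
  then obtain r where r: "\<Phi> p p = of_real r" by (metis Reals_cases Reals_cnj_iff)
  with assms have "r \<noteq> 0" by auto
  have "(cmod (z p + ?b / r))\<^sup>2 = (cmod (z p))\<^sup>2 + 2 * Re (cnj (z p) * ?b) / r + (cmod ?b)\<^sup>2 / r\<^sup>2"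
    unfolding cmod_power2 using \<open>r \<noteq> 0\<close>
    by (simp add: field_simps power2_eq_square)
  then have "r * (cmod (z p + ?b / r))\<^sup>2 = r * (cmod (z p))\<^sup>2 + 2 * Re (cnj (z p) * ?b) + (cmod ?b)\<^sup>2 / r"
    using \<open>r \<noteq> 0\<close> by (simp add: field_simps power2_eq_square)
  from arg_cong[OF this, of complex_of_real] have "complex_of_real r * (cmod (z p + ?b / r))\<^sup>2 = complex_of_real (r * (cmod (z p))\<^sup>2 + 2 * Re (cnj (z p) * ?b) + (cmod ?b)\<^sup>2 / r)"
    by (simp only: of_real_mult)
  then show ?thesis
    unfolding qform_insert[OF assms(1-3)] qform_schur_complement[OF assms(1-3)] r
    by (simp only: of_real_add of_real_divide of_real_mult) simp
qed

text \<open>With a zero pivot the form is affine in the pivot coordinate, so a nonzero cross term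
  could drive it below zero.\<close>

lemma psd_zero_pivot_row:
  assumes "finite I" "p \<notin> I" "hermitian_on (insert p I) \<Phi>"
    and psd: "\<And>z. 0 \<le> Re (qform (insert p I) \<Phi> z)"
    and "\<Phi> p p = 0" "j \<in> I"
  shows "\<Phi> p j = 0"
proof (rule ccontr)
  assume nz: "\<Phi> p j \<noteq> 0"
  \<comment> \<open>Scaled so that the cross term becomes
    \<open>- 2 * (\<bar>Re (\<Phi> j j)\<bar> + 1)\<close>, which outweighs the diagonal entry of
    \<open>j\<close>.\<close>
  define s where "s = (\<bar>Re (\<Phi> j j)\<bar> + 1) / (cmod (\<Phi> p j))\<^sup>2"
  define z where "z = (\<lambda>i. if i = p then - of_real s * \<Phi> p j else if i = j then 1 else (0::complex))"
  have "j \<noteq> p" using assms by auto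
  have b: "(\<Sum>k\<in>I. \<Phi> p k * z k) = \<Phi> p j"
  proof -
    have "(\<Sum>k\<in>I. \<Phi> p k * z k) = (\<Sum>k\<in>I. if k = j then \<Phi> p k else 0)"
      using assms(2) by (intro sum.cong) (auto simp: z_def)
    then show ?thesis using assms by simp
  qed
  have q: "qform I \<Phi> z = \<Phi> j j"
  proof -
    have "qform I \<Phi> z = (\<Sum>i\<in>I. if i = j then (\<Sum>k\<in>I. if k = j then \<Phi> i k else 0) else 0)"
      unfolding qform_def using assms(2) by (intro sum.cong) (auto simp: z_def intro!: sum.cong)
    then show ?thesis using assms by simp
  qed
  have "cnj (z p) * \<Phi> p j = - complex_of_real (s * (cmod (\<Phi> p j))\<^sup>2)"
    using cnj_mult_self[of "\<Phi> p j"] by (simp add: z_def)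
  then have "Re (qform (insert p I) \<Phi> z) = - 2 * (s * (cmod (\<Phi> p j))\<^sup>2) + Re (\<Phi> j j)"
    unfolding qform_insert[OF assms(1-3)] b q using \<open>\<Phi> p p = 0\<close> by simp
  also have "\<dots> < 0" using nz by (simp add: s_def)
  finally show False using psd[of z] by simp
qed

lemma psd_schur_complement:
  assumes "finite I" "p \<notin> I" "hermitian_on (insert p I) \<Phi>"
    and psd: "\<And>z. 0 \<le> Re (qform (insert p I) \<Phi> z)"
  shows "0 \<le> Re (qform I (schur_complement p \<Phi>) z)"
proof -
  \<comment> \<open>This pivot coordinate annihilates the completed square, leaving exactly the
    Schur form. For a zero pivot it is 0 by division by zero.\<close>
  define w where "w = z(p := - (\<Sum>j\<in>I. \<Phi> p j * z j) / \<Phi> p p)"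
  have wz: "w i = z i" if "i \<in> I" for i using that assms(2) by (auto simp: w_def)
  then have b: "(\<Sum>j\<in>I. \<Phi> p j * w j) = (\<Sum>j\<in>I. \<Phi> p j * z j)" by simp
  have q: "qform I \<Psi> w = qform I \<Psi> z" for \<Psi> by (rule qform_cong) (simp_all add: wz)
  show ?thesis
  proof (cases "\<Phi> p p = 0")
    case True
    then show ?thesis
      using psd[of w] unfolding qform_insert[OF assms(1-3)] qform_schur_complement[OF assms(1-3)] b q
      by (simp add: w_def)
  next
    case False
    then show ?thesis
      using psd[of w] unfolding qform_complete_square[OF assms(1-3) False] b q
      by (simp add: w_def)
  qed
qed

lemma psd_diagonal:
  assumes "finite I" "p \<notin> I" "hermitian_on (insert p I) \<Phi>"
    and psd: "\<And>z. 0 \<le> Re (qform (insert p I) \<Phi> z)"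
  obtains r where "\<Phi> p p = of_real r" "0 \<le> r"
proof -
  have "cnj (\<Phi> p p) = \<Phi> p p" using hermitian_onD[OF assms(3), of p p] by blast
  then obtain r where r: "\<Phi> p p = of_real r" by (metis Reals_cases Reals_cnj_iff)
  define z where "z = (\<lambda>i. if i = p then 1 else (0::complex))"
  have "z i = 0" if "i \<in> I" for i using that assms(2) by (auto simp: z_def)
  then have "qform I \<Phi> z = 0" "(\<Sum>j\<in>I. \<Phi> p j * z j) = 0" by (simp_all add: qform_def)
  then have "0 \<le> r" using psd[of z] unfolding qform_insert[OF assms(1-3)] r by (simp add: z_def)
  with r that show ?thesis by blast
qed

text \<open>Cholesky factorization, pivoting first on the block \<open>J\<close> so that the rows of the factor
  indexed by \<open>J\<close> are unit vectors.\<close>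

lemma psd_factorization:
  fixes \<Phi> :: "'i \<Rightarrow> 'i \<Rightarrow> complex"
  assumes "finite I" "hermitian_on I \<Phi>" "\<And>z. 0 \<le> Re (qform I \<Phi> z)" "J \<subseteq> I"
    and "\<And>i j. i \<in> J \<Longrightarrow> j \<in> J \<Longrightarrow> \<Phi> i j = (if i = j then 1 else 0)"
  shows "\<exists>X. (\<forall>i\<in>I. \<forall>j\<in>I. \<Phi> i j = (\<Sum>c\<in>I. X i c * cnj (X j c))) \<and>
    (\<forall>i\<in>J. \<forall>c\<in>I. X i c = (if i = c then 1 else 0)) \<and>
    ((\<exists>z. (\<exists>i\<in>I. z i \<noteq> 0) \<and> qform I \<Phi> z = 0) \<longrightarrow> (\<exists>c\<in>I. \<forall>i\<in>I. X i c = 0))"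
  using assms
proof (induction "card I" arbitrary: I J \<Phi>)
  case 0
  then have "I = {}" "J = {}" by simp_all
  then show ?case by simp
next
  case (Suc n)
  then have "I \<noteq> {}" by auto
  \<comment> \<open>Indices of \<open>J\<close> are pivoted first, as long as there are any.\<close>
  obtain p where p: "p \<in> I" "J \<noteq> {} \<Longrightarrow> p \<in> J"
    using \<open>I \<noteq> {}\<close> \<open>J \<subseteq> I\<close> by (metis ex_in_conv subsetD)
  define I' where "I' = I - {p}"
  have I: "I = insert p I'" "p \<notin> I'" "finite I'" "n = card I'"
    using p Suc by (auto simp: I'_def)
  note herm = Suc.prems(2)[unfolded I(1)] and psd = Suc.prems(3)[unfolded I(1)]
  note pivot = I(3,2) herm
  let ?\<Psi> = "schur_complement p \<Phi>"
  obtain r where r: "\<Phi> p p = of_real r" "0 \<le> r"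
    by (rule psd_diagonal[OF pivot psd])
  have row: "\<Phi> p j = 0" "\<Phi> j p = 0" if "r = 0" "j \<in> I" for j
  proof -
    show *: "\<Phi> p j = 0"
      using psd_zero_pivot_row[OF pivot psd, of j] that r I by auto
    show "\<Phi> j p = 0"
      using hermitian_onD[OF herm, of p j] that I * by auto
  qed
  have "\<exists>X. (\<forall>i\<in>I'. \<forall>j\<in>I'. ?\<Psi> i j = (\<Sum>c\<in>I'. X i c * cnj (X j c))) \<and>
    (\<forall>i\<in>J - {p}. \<forall>c\<in>I'. X i c = (if i = c then 1 else 0)) \<and>
    ((\<exists>z. (\<exists>i\<in>I'. z i \<noteq> 0) \<and> qform I' ?\<Psi> z = 0) \<longrightarrow> (\<exists>c\<in>I'. \<forall>i\<in>I'. X i c = 0))"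
  proof (rule Suc.hyps(1)[OF I(4) I(3)])
    show "hermitian_on I' ?\<Psi>" by (rule hermitian_schur_complement[OF herm])
    show "0 \<le> Re (qform I' ?\<Psi> z)" for z by (rule psd_schur_complement[OF pivot psd])
    show "J - {p} \<subseteq> I'" using Suc.prems(4) by (auto simp: I'_def)
    \<comment> \<open>A nonempty \<open>J\<close> contains \<open>p\<close>, so
      \<open>\<Phi> i p = 0\<close> here and the elimination does not alter the identity
      block.\<close>
    show "?\<Psi> i j = (if i = j then 1 else 0)" if "i \<in> J - {p}" "j \<in> J - {p}" for i j
      using Suc.prems(5)[of i j] Suc.prems(5)[of i p] that p(2) by (auto simp: schur_complement_def)
  qed
  then obtain Y where Y: "\<And>i j. i \<in> I' \<Longrightarrow> j \<in> I' \<Longrightarrow> ?\<Psi> i j = (\<Sum>c\<in>I'. Y i c * cnj (Y j c))"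
      "\<And>i c. i \<in> J - {p} \<Longrightarrow> c \<in> I' \<Longrightarrow> Y i c = (if i = c then 1 else 0)"
      "(\<exists>z. (\<exists>i\<in>I'. z i \<noteq> 0) \<and> qform I' ?\<Psi> z = 0) \<longrightarrow> (\<exists>c\<in>I'. \<forall>i\<in>I'. Y i c = 0)"
    by blast
  \<comment> \<open>Column \<open>p\<close> is that of \<open>\<Phi>\<close> divided by the square
    root of the pivot; the rest factors the Schur complement and has zero row \<open>p\<close>. For
    \<open>r = 0\<close> division by zero makes column \<open>p\<close> vanish, in agreement with
    \<open>row\<close>.\<close>
  define X where "X i c = (if c = p then \<Phi> i p / of_real (sqrt r) else if i = p then 0 else Y i c)" for i c
  have X: "(\<Sum>c\<in>I. X i c * cnj (X j c)) =
      \<Phi> i p * cnj (\<Phi> j p) / of_real r + (if i = p \<or> j = p then 0 else \<Sum>c\<in>I'. Y i c * cnj (Y j c))" for i j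
  proof -
    have "X i p * cnj (X j p) = \<Phi> i p * cnj (\<Phi> j p) / of_real r"
      using r(2) by (simp add: X_def flip: of_real_mult)
    moreover have "(\<Sum>c\<in>I'. X i c * cnj (X j c)) =
        (if i = p \<or> j = p then 0 else \<Sum>c\<in>I'. Y i c * cnj (Y j c))"
      using I(2) by (auto simp: X_def intro!: sum.cong sum.neutral)
    ultimately show ?thesis using I by simp
  qed
  have XI: "\<Phi> i j = (\<Sum>c\<in>I. X i c * cnj (X j c))" if ij: "i \<in> I" "j \<in> I" for i j
  proof -
    have cj: "cnj (\<Phi> j p) = \<Phi> p j" using hermitian_onD[OF herm, of j p] ij I by auto
    consider "i = p" | "j = p" | "i \<in> I'" "j \<in> I'" using ij I by auto
    then show ?thesis
    proof cases
      case 1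
      then show ?thesis unfolding X cj using r row[of j] ij by auto
    next
      case 2
      then show ?thesis unfolding X using r row[of i] ij by auto
    next
      case 3
      then have "i \<noteq> p" "j \<noteq> p" using I by auto
      then show ?thesis unfolding X cj using Y(1)[OF 3] r by (simp add: schur_complement_def diff_eq_eq add.commute)
    qed
  qed
  have XJ: "X i c = (if i = c then 1 else 0)" if ic: "i \<in> J" "c \<in> I" for i c
  proof (cases "c = p")
    case True
    have "p \<in> J" using p ic by auto
    then have "r = 1" using Suc.prems(5)[of p p] r by auto
    then show ?thesis using Suc.prems(5)[of i p] \<open>p \<in> J\<close> ic True by (simp add: X_def)
  next
    case False
    then show ?thesis using Y(2)[of i c] ic I by (auto simp: X_def)
  qed
  have Xnull: "\<exists>c\<in>I. \<forall>i\<in>I. X i c = 0" if z: "\<exists>i\<in>I. z i \<noteq> 0" "qform I \<Phi> z = 0" for z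
  proof (cases "r = 0")
    case True
    then show ?thesis using p(1) by (auto simp: X_def)
  next
    case False
    then have nz: "\<Phi> p p \<noteq> 0" using r by simp
    let ?s = "(cmod (z p + (\<Sum>j\<in>I'. \<Phi> p j * z j) / \<Phi> p p))\<^sup>2"
    \<comment> \<open>Completing the square writes the vanishing form as a sum of two nonnegative
      terms, so both are zero.\<close>
    have eq: "complex_of_real (r * ?s) + qform I' ?\<Psi> z = 0"
      using z(2) unfolding I(1) qform_complete_square[OF pivot nz] r of_real_mult .
    have "0 \<le> Re (qform I' ?\<Psi> z)" by (rule psd_schur_complement[OF pivot psd])
    moreover have "r * ?s + Re (qform I' ?\<Psi> z) = 0" using arg_cong[OF eq, of Re] by simp
    moreover have "0 \<le> r * ?s" using r by simp
    ultimately have "r * ?s = 0" by linarith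
    then have *: "z p + (\<Sum>j\<in>I'. \<Phi> p j * z j) / \<Phi> p p = 0" and q: "qform I' ?\<Psi> z = 0"
      using False eq by simp_all
    \<comment> \<open>If \<open>z\<close> vanished on \<open>I'\<close>, the vanishing square would
      force \<open>z p = 0\<close> as well.\<close>
    have "\<exists>i\<in>I'. z i \<noteq> 0"
    proof (rule ccontr)
      assume "\<not> ?thesis"
      then show False using * z(1) I(1) by auto
    qed
    with q Y(3) obtain c where "c \<in> I'" "\<forall>i\<in>I'. Y i c = 0" by blast
    then show ?thesis using I by (intro bexI[of _ c]) (auto simp: X_def)
  qed
  show ?case
  proof (intro exI[of _ X] conjI ballI impI)
    assume "\<exists>z. (\<exists>i\<in>I. z i \<noteq> 0) \<and> qform I \<Phi> z = 0"
    then show "\<exists>c\<in>I. \<forall>i\<in>I. X i c = 0" using Xnull by (elim exE conjE)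
  qed (fact XI XJ)+
qed

section \<open>Singular shifts of the identity and Hermitian directions\<close>

lemma continuous_on_coordinate: "continuous_on S (\<lambda>f. f i)"
  by (rule continuous_on_subset[OF continuous_on_product_coordinates]) simp

lemma continuous_on_qform: "continuous_on S (qform I D)"
  unfolding qform_def by (intro continuous_intros continuous_on_coordinate)

lemma qform_scale: "qform I D (\<lambda>i. of_real s * z i) = of_real (s\<^sup>2) * qform I D z"
  by (simp add: qform_def sum_distrib_left power2_eq_square mult_ac)

lemma qform_identity_plus:
  assumes "finite I"
  shows "qform I (\<lambda>i j. (if i = j then 1 else 0) + of_real t * D i j) z =
    of_real (\<Sum>i\<in>I. (cmod (z i))\<^sup>2) + of_real t * qform I D z"
proof -
  have "(\<Sum>j\<in>I. cnj (z i) * (if i = j then 1 else 0) * z j) = of_real ((cmod (z i))\<^sup>2)" if "i \<in> I" for i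
  proof -
    have "(\<Sum>j\<in>I. cnj (z i) * (if i = j then 1 else 0) * z j) = (\<Sum>j\<in>I. if i = j then cnj (z i) * z j else 0)"
      by (intro sum.cong) auto
    also have "\<dots> = cnj (z i) * z i" using assms that by simp
    finally show ?thesis by (simp only: cnj_mult_self)
  qed
  then show ?thesis
    by (simp add: qform_def ring_distribs sum.distrib sum_distrib_left mult_ac)
qed

text \<open>Let \<open>\<mu> < 0\<close> be the minimum of the form of \<open>D\<close> on the unit
  sphere. The shifted form has least value \<open>1 + t * \<mu>\<close> there, which reaches zero at
  \<open>t = - 1 / \<mu>\<close>, attained at the minimizer.\<close>

lemma indefinite_shift_singular:
  assumes "finite I" "Re (qform I D z0) < 0"
  obtains t where "0 < t"
    and "\<And>z. 0 \<le> Re (qform I (\<lambda>i j. (if i = j then 1 else 0) + of_real t * D i j) z)"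
    and "\<exists>z. (\<exists>i\<in>I. z i \<noteq> 0) \<and> Re (qform I (\<lambda>i j. (if i = j then 1 else 0) + of_real t * D i j) z) = 0"
proof -
  define nn where "nn z = (\<Sum>i\<in>I. (cmod (z i))\<^sup>2)" for z :: "'a \<Rightarrow> complex"
  \<comment> \<open>The unit sphere over \<open>I\<close>, written inside a box that supplies
    compactness.\<close>
  define S where "S = {z. (\<forall>i\<in>I. cmod (z i) \<le> 1) \<and> (\<forall>i. i \<notin> I \<longrightarrow> z i = 0)} \<inter> {z. nn z = 1}"
  have cont: "continuous_on UNIV nn"
    unfolding nn_def by (intro continuous_intros continuous_on_coordinate)
  have "compact S"
    unfolding S_def
    by (intro compact_Int_closed compact_bounded_support closed_Collect_eq cont continuous_intros)
  have nn0: "nn z = 0 \<longleftrightarrow> (\<forall>i\<in>I. z i = 0)" for z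
    using assms(1) by (simp add: nn_def sum_nonneg_eq_0_iff)
  have nn_ge: "0 \<le> nn z" for z by (simp add: nn_def sum_nonneg)
  \<comment> \<open>Scaling to norm one: every Rayleigh quotient is a value of the form on the
    sphere.\<close>
  have normalize: "\<exists>y\<in>S. Re (qform I D y) = Re (qform I D z) / nn z" if "nn z \<noteq> 0" for z
  proof
    define s where "s = 1 / sqrt (nn z)"
    have s2: "s\<^sup>2 = 1 / nn z" using nn_ge[of z] by (simp add: s_def power_divide)
    let ?y = "\<lambda>i. if i \<in> I then of_real s * z i else 0"
    have nny: "nn ?y = s\<^sup>2 * nn z"
      unfolding nn_def by (simp add: norm_mult power_mult_distrib sum_distrib_left)
    then have nny: "nn ?y = 1" using s2 that by simp
    have "(cmod (?y i))\<^sup>2 \<le> 1" if "i \<in> I" for i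
      unfolding nny[symmetric] nn_def
      by (rule member_le_sum[of i I "\<lambda>i. (cmod (?y i))\<^sup>2"]) (use that assms in auto)
    then have "cmod (?y i) \<le> 1" if "i \<in> I" for i
      using that abs_square_le_1[of "cmod (?y i)"] by simp
    with nny show "?y \<in> S" by (simp add: S_def)
    have "qform I D ?y = qform I D (\<lambda>i. of_real s * z i)" by (rule qform_cong) simp_all
    then show "Re (qform I D ?y) = Re (qform I D z) / nn z" by (simp add: qform_scale s2)
  qed
  have z0: "nn z0 \<noteq> 0"
  proof
    assume "nn z0 = 0"
    then have "qform I D z0 = 0" by (simp add: nn0 qform_def)
    with assms show False by simp
  qed
  from normalize[OF z0] obtain y where y: "y \<in> S" "Re (qform I D y) = Re (qform I D z0) / nn z0" by blast
  then have "S \<noteq> {}" by auto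
  have "continuous_on S (\<lambda>z. Re (qform I D z))"
    by (intro continuous_intros continuous_on_qform)
  from continuous_attains_inf[OF \<open>compact S\<close> \<open>S \<noteq> {}\<close> this]
  obtain m where m: "m \<in> S" "\<And>z. z \<in> S \<Longrightarrow> Re (qform I D m) \<le> Re (qform I D z)" by blast
  define \<mu> where "\<mu> = Re (qform I D m)"
  have "Re (qform I D z0) / nn z0 < 0" using assms z0 nn_ge[of z0] by (simp add: divide_neg_pos)
  then have "\<mu> < 0" using m(2)[OF y(1)] y(2) by (simp add: \<mu>_def)
  define t where "t = - 1 / \<mu>"
  have form: "Re (qform I (\<lambda>i j. (if i = j then 1 else 0) + of_real t * D i j) z) = nn z + t * Re (qform I D z)" for z
    unfolding qform_identity_plus[OF assms(1)] nn_def by simp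
  show ?thesis
  proof (rule that)
    show "0 < t" using \<open>\<mu> < 0\<close> by (simp add: t_def)
    show "0 \<le> Re (qform I (\<lambda>i j. (if i = j then 1 else 0) + of_real t * D i j) z)" for z
    proof (cases "nn z = 0")
      case True
      then show ?thesis unfolding form by (simp add: nn0 nn_ge qform_def)
    next
      case False
      then obtain y where "y \<in> S" "Re (qform I D y) = Re (qform I D z) / nn z" using normalize by blast
      then have "\<mu> \<le> Re (qform I D z) / nn z" using m(2)[of y] by (simp add: \<mu>_def)
      then have "\<mu> * nn z \<le> Re (qform I D z)" using False nn_ge[of z] by (simp add: pos_le_divide_eq)
      then have "t * (\<mu> * nn z) \<le> t * Re (qform I D z)" using \<open>0 < t\<close> by (simp add: mult_left_mono)
      moreover have "t * \<mu> = - 1" using \<open>\<mu> < 0\<close> by (simp add: t_def)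
      then have "t * (\<mu> * nn z) = - nn z" by (simp flip: mult.assoc)
      ultimately show ?thesis unfolding form by simp
    qed
    have "nn m = 1" using m(1) by (simp add: S_def)
    then have "nn m + t * Re (qform I D m) = 0" using \<open>\<mu> < 0\<close> by (simp add: t_def \<mu>_def)
    then show "\<exists>z. (\<exists>i\<in>I. z i \<noteq> 0) \<and> Re (qform I (\<lambda>i j. (if i = j then 1 else 0) + of_real t * D i j) z) = 0"
      using nn0[of m] \<open>nn m = 1\<close> by (intro exI[of _ m] conjI) (simp_all add: form)
  qed
qed

lemma hermitian_form_nonzero:
  assumes "finite I" "hermitian_on I D" "i \<in> I" "j \<in> I" "D i j \<noteq> 0"
  shows "\<exists>z. Re (qform I D z) \<noteq> 0"
proof (rule ccontr)
  assume "\<nexists>z. Re (qform I D z) \<noteq> 0"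
  then have zero: "Re (qform I D z) = 0" for z by blast
  have supp: "qform I D z = qform A D z" if "A \<subseteq> I" "\<And>k. k \<in> I - A \<Longrightarrow> z k = 0" for A z
    unfolding qform_def using assms(1) that
    by (intro sum.mono_neutral_cong_right ballI) (auto intro: sum.mono_neutral_right)
  have diag: "D k k = 0" if "k \<in> I" for k
  proof -
    have "qform I D (\<lambda>l. if l = k then 1 else 0) = D k k"
      using supp[of "{k}" "\<lambda>l. if l = k then 1 else 0"] that by (simp add: qform_def)
    then have "Re (D k k) = 0" using zero by metis
    moreover have "Im (D k k) = 0"
      using arg_cong[OF hermitian_onD[OF assms(2) that that], of Im] by simp
    ultimately show ?thesis by (simp add: complex_eq_iff)
  qed
  with assms have "i \<noteq> j" by auto
  \<comment> \<open>The phase of the second coordinate makes both cross terms equal to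
    \<open>(cmod (D i j))\<^sup>2\<close>, while the diagonal terms are already known to
    vanish.\<close>
  define z where "z = (\<lambda>l. if l = i then 1 else if l = j then cnj (D i j) else 0)"
  have "qform I D z = qform {i, j} D z"
    by (rule supp) (use assms in \<open>auto simp: z_def\<close>)
  also have "\<dots> = D i j * cnj (D i j) + D i j * D j i"
    using \<open>i \<noteq> j\<close> diag assms by (simp add: qform_def z_def)
  also have "D j i = cnj (D i j)" using hermitian_onD assms by metis
  finally have "Re (qform I D z) = 2 * (cmod (D i j))\<^sup>2"
    by (simp add: complex_mult_cnj cmod_power2)
  with zero[of z] assms(5) show False by simp
qed

text \<open>A Hermitian matrix is parametrized by a real matrix \<open>x\<close> of the same size, whose entries above
  and below the diagonal hold the real and imaginary parts.\<close>

lemma hermitian_solution: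
  fixes Q :: "'e \<Rightarrow> nat \<Rightarrow> nat \<Rightarrow> complex"
  assumes "K \<le> N" "finite E" "K\<^sup>2 + card E < N\<^sup>2"
  obtains D where "hermitian_on {..<N} D" "\<exists>i<N. \<exists>j<N. D i j \<noteq> 0"
    "\<And>i j. i < K \<Longrightarrow> j < K \<Longrightarrow> D i j = 0"
    "\<And>e. e \<in> E \<Longrightarrow> Re (\<Sum>i<N. \<Sum>j<N. D i j * Q e i j) = 0"
proof -
  \<comment> \<open>For \<open>i < j\<close> this gives
    \<open>D i j = x (i, j) + \<i> * x (j, i)\<close>. The weight 1/2 compensates for a diagonal
    entry being added twice.\<close>
  define \<alpha> :: "nat \<Rightarrow> nat \<Rightarrow> complex" where
    "\<alpha> i j = (if i < j then 1 else if i = j then 1 / 2 else - \<i>)" for i j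
  \<comment> \<open>The unknowns are the \<open>N^2 - K^2\<close> entries outside the
    \<open>K x K\<close> block, so that block of \<open>D\<close> is zero by construction.\<close>
  define I where "I = {..<N} \<times> {..<N} - {..<K} \<times> {..<K}"
  have "finite I" by (simp add: I_def)
  have "card I = N\<^sup>2 - K\<^sup>2"
    using assms(1) unfolding I_def
    by (subst card_Diff_subset) (auto simp: power2_eq_square card_cartesian_product)
  with assms(3) have "card E < card I" by linarith
  \<comment> \<open>The coefficient of \<open>x (i, j)\<close> collects its occurrences in
    \<open>D i j\<close> and in \<open>D j i\<close>.\<close>
  from underdetermined_system_nontrivial_solution[OF assms(2) \<open>finite I\<close> this,
      of "\<lambda>e (i, j). Re (\<alpha> i j * Q e i j + cnj (\<alpha> i j) * Q e j i)"]
  obtain x where x: "\<exists>p\<in>I. x p \<noteq> 0" "\<And>p. p \<notin> I \<Longrightarrow> x p = 0"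
    "\<And>e. e \<in> E \<Longrightarrow> (\<Sum>(i, j)\<in>I. Re (\<alpha> i j * Q e i j + cnj (\<alpha> i j) * Q e j i) * x (i, j)) = 0"
    by (auto simp: case_prod_beta')
  define D where "D i j = \<alpha> i j * x (i, j) + cnj (\<alpha> j i) * x (j, i)" for i j
  have "Re (\<Sum>i<N. \<Sum>j<N. D i j * Q e i j) = 0" if "e \<in> E" for e
  proof -
    have "(\<Sum>i<N. \<Sum>j<N. D i j * Q e i j) =
        (\<Sum>i<N. \<Sum>j<N. \<alpha> i j * x (i, j) * Q e i j) + (\<Sum>i<N. \<Sum>j<N. cnj (\<alpha> j i) * x (j, i) * Q e i j)"
      by (simp add: D_def ring_distribs sum.distrib)
    also have "(\<Sum>i<N. \<Sum>j<N. cnj (\<alpha> j i) * x (j, i) * Q e i j) =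
        (\<Sum>i<N. \<Sum>j<N. cnj (\<alpha> i j) * x (i, j) * Q e j i)"
      by (rule sum.swap)
    finally have "(\<Sum>i<N. \<Sum>j<N. D i j * Q e i j) =
        (\<Sum>i<N. \<Sum>j<N. of_real (x (i, j)) * (\<alpha> i j * Q e i j + cnj (\<alpha> i j) * Q e j i))"
      by (simp add: ring_distribs sum.distrib mult_ac)
    then have "Re (\<Sum>i<N. \<Sum>j<N. D i j * Q e i j) =
        (\<Sum>(i, j)\<in>{..<N} \<times> {..<N}. Re (\<alpha> i j * Q e i j + cnj (\<alpha> i j) * Q e j i) * x (i, j))"
      by (simp add: sum.cartesian_product[symmetric] mult.commute)
    also have "\<dots> = (\<Sum>(i, j)\<in>I. Re (\<alpha> i j * Q e i j + cnj (\<alpha> i j) * Q e j i) * x (i, j))"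
      by (rule sum.mono_neutral_right) (use x(2) in \<open>auto simp: I_def\<close>)
    finally show ?thesis using x(3)[OF that] by simp
  qed
  moreover have "hermitian_on {..<N} D" by (simp add: hermitian_on_def D_def add.commute)
  moreover have "\<exists>i<N. \<exists>j<N. D i j \<noteq> 0"
  proof (rule ccontr)
    assume "\<not> ?thesis"
    then have D0: "D i j = 0" if "i < N" "j < N" for i j using that by blast
    obtain i j where ij: "(i, j) \<in> I" "x (i, j) \<noteq> 0" using x(1) by auto
    then have "i < N" "j < N" by (auto simp: I_def)
    with D0 have "D i j = 0" "D j i = 0" by blast+
    with ij(2) show False
      by (cases i j rule: linorder_cases) (auto simp: D_def \<alpha>_def complex_eq_iff)
  qed
  moreover have "D i j = 0" if "i < K" "j < K" for i j
    using that x(2) by (simp add: D_def I_def)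
  ultimately show ?thesis using that by blast
qed

subsection \<open>Removing a beamformer\<close>

text \<open>Entries of \<open>V V^H\<close>; the second index of \<open>v\<close> runs over the
  beamformers.\<close>

definition gram :: "nat \<Rightarrow> (nat \<Rightarrow> nat \<Rightarrow> complex) \<Rightarrow> nat \<Rightarrow> nat \<Rightarrow> complex" where
  "gram N v a b = (\<Sum>j<N. v a j * cnj (v b j))"

definition response :: "nat \<Rightarrow> (nat \<Rightarrow> nat \<Rightarrow> complex) \<Rightarrow> (nat \<Rightarrow> nat \<Rightarrow> complex) \<Rightarrow> nat \<Rightarrow> nat \<Rightarrow> complex" where
  "response d h v k j = (\<Sum>a<d. v a j * cnj (h k a))"

text \<open>Without interference cancellation, sensing beamformers disturb a user just as foreign
  communication beamformers do, so one sum over all other columns replaces the two terms of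
  \<open>sinr_NIC\<close>.\<close>

definition sinr :: "nat \<Rightarrow> (nat \<Rightarrow> nat \<Rightarrow> complex) \<Rightarrow> real \<Rightarrow> nat \<Rightarrow> (nat \<Rightarrow> nat \<Rightarrow> complex) \<Rightarrow> nat \<Rightarrow> real" where
  "sinr d h s N v k = (cmod (response d h v k k))\<^sup>2 /
     ((\<Sum>j\<in>{..<N} - {k}. (cmod (response d h v k j))\<^sup>2) + s)"

text \<open>The total power reaching user \<open>k\<close> is \<open>h_k^H V V^H h_k\<close>. For a
  fixed Gram matrix, useful signal and interference therefore trade off exactly.\<close>

lemma response_power:
  "(\<Sum>j<N. (cmod (response d h v k j))\<^sup>2) = Re (\<Sum>a<d. \<Sum>b<d. cnj (h k a) * gram N v a b * h k b)"
proof -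
  have "complex_of_real ((cmod (response d h v k j))\<^sup>2) =
      (\<Sum>a<d. \<Sum>b<d. cnj (h k a) * (v a j * cnj (v b j)) * h k b)" for j
  proof -
    have "complex_of_real ((cmod (response d h v k j))\<^sup>2) = response d h v k j * cnj (response d h v k j)"
      by (simp only: cnj_mult_self[symmetric] mult.commute)
    also have "\<dots> = (\<Sum>a<d. \<Sum>b<d. cnj (h k a) * (v a j * cnj (v b j)) * h k b)"
      unfolding response_def cnj_sum sum_product by (simp add: mult_ac)
    finally show ?thesis .
  qed
  then have "complex_of_real (\<Sum>j<N. (cmod (response d h v k j))\<^sup>2) =
      (\<Sum>j<N. \<Sum>a<d. \<Sum>b<d. cnj (h k a) * (v a j * cnj (v b j)) * h k b)"
    by (simp only: of_real_sum)
  also have "\<dots> = (\<Sum>a<d. \<Sum>j<N. \<Sum>b<d. cnj (h k a) * (v a j * cnj (v b j)) * h k b)"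
    by (rule sum.swap)
  also have "\<dots> = (\<Sum>a<d. \<Sum>b<d. \<Sum>j<N. cnj (h k a) * (v a j * cnj (v b j)) * h k b)"
    by (intro sum.cong refl sum.swap)
  also have "\<dots> = (\<Sum>a<d. \<Sum>b<d. cnj (h k a) * gram N v a b * h k b)"
    by (simp add: gram_def sum_distrib_left sum_distrib_right)
  finally show ?thesis by (metis Re_complex_of_real)
qed

lemma response_power_cong:
  assumes "\<And>a b. a < d \<Longrightarrow> b < d \<Longrightarrow> gram N v a b = gram N w a b"
  shows "(\<Sum>j<N. (cmod (response d h v k j))\<^sup>2) = (\<Sum>j<N. (cmod (response d h w k j))\<^sup>2)"
  unfolding response_power using assms by simp

text \<open>A unitary 2 x 2 matrix acts on columns \<open>i\<close> and \<open>j\<close>, which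
  leaves \<open>V V^H\<close> fixed. When \<open>x\<close> and \<open>y\<close> are the responses of
  a user to the two columns, the new column \<open>i\<close> combines both coherently.\<close>

lemma rotate_columns:
  fixes x y :: complex
  assumes "i < N" "j < N" "i \<noteq> j" "y \<noteq> 0"
  obtains w where "\<And>a b. gram N w a b = gram N v a b"
    and "\<And>a. w a i = (cnj x * v a i + cnj y * v a j) / of_real (sqrt ((cmod x)\<^sup>2 + (cmod y)\<^sup>2))"
    and "\<And>a c. c \<noteq> i \<Longrightarrow> c \<noteq> j \<Longrightarrow> w a c = v a c"
proof -
  define r where "r = sqrt ((cmod x)\<^sup>2 + (cmod y)\<^sup>2)"
  have r: "complex_of_real r * complex_of_real r = x * cnj x + y * cnj y"
    unfolding r_def of_real_mult[symmetric] by (simp add: complex_norm_square flip: of_real_power)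
  have "r \<noteq> 0" using assms(4) by (simp add: r_def add_nonneg_eq_0_iff)
  define w where "w a c = (if c = i then (cnj x * v a i + cnj y * v a j) / of_real r
     else if c = j then (x * v a j - y * v a i) / of_real r else v a c)" for a c
  have 1: "w a i = (cnj x * v a i + cnj y * v a j) / of_real (sqrt ((cmod x)\<^sup>2 + (cmod y)\<^sup>2))" for a
    by (simp add: w_def r_def)
  have 2: "w a c = v a c" if "c \<noteq> i" "c \<noteq> j" for a c
    using that by (simp add: w_def)
  have split: "(\<Sum>c<N. f c) = f i + f j + (\<Sum>c\<in>{..<N} - {i, j}. f c)" for f :: "nat \<Rightarrow> complex"
  proof -
    have "(\<Sum>c<N. f c) = (\<Sum>c\<in>{i, j}. f c) + (\<Sum>c\<in>{..<N} - {i, j}. f c)"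
      using assms by (subst sum.subset_diff[of "{i, j}"]) auto
    then show ?thesis using assms(3) by simp
  qed
  have 3: "gram N w a b = gram N v a b" for a b
  proof -
    have "w a i * cnj (w b i) + w a j * cnj (w b j) =
       ((x * cnj x + y * cnj y) * (v a i * cnj (v b i) + v a j * cnj (v b j))) / (of_real r * of_real r)"
      using assms(3)
      by (simp add: w_def flip: add_divide_distrib) (simp add: algebra_simps)
    also have "\<dots> = v a i * cnj (v b i) + v a j * cnj (v b j)"
      unfolding r[symmetric] using \<open>r \<noteq> 0\<close> by simp
    finally have "w a i * cnj (w b i) + w a j * cnj (w b j) = v a i * cnj (v b i) + v a j * cnj (v b j)" .
    moreover have "(\<Sum>c\<in>{..<N} - {i, j}. w a c * cnj (w b c)) = (\<Sum>c\<in>{..<N} - {i, j}. v a c * cnj (v b c))"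
      by (rule sum.cong) (auto simp: w_def)
    ultimately show ?thesis unfolding gram_def split by simp
  qed
  show ?thesis by (rule that[of w]) (fact 3, fact 1, fact 2)
qed

text \<open>Among all matrices with the given Gram matrix and no smaller useful signals, take one with
  maximal total useful signal: if column \<open>j \<ge> K\<close> still reached user \<open>k\<close>, rotating columns \<open>k\<close> and
  \<open>j\<close> would increase the signal of user \<open>k\<close> and leave the other useful signals unchanged.\<close>

lemma exists_null_steered_sensing:
  assumes "K \<le> N"
  obtains w where "\<And>a b. a < d \<Longrightarrow> b < d \<Longrightarrow> gram N w a b = gram N v a b"
    and "\<And>k. k < K \<Longrightarrow> cmod (response d h v k k) \<le> cmod (response d h w k k)"
    and "\<And>k j. k < K \<Longrightarrow> K \<le> j \<Longrightarrow> j < N \<Longrightarrow> response d h w k j = 0"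
proof -
  let ?C = "\<lambda>f :: nat \<times> nat \<Rightarrow> complex. \<lambda>a j. f (a, j)"
  define I where "I = {..<d} \<times> {..<N}"
  define r where "r = (\<lambda>(a, j :: nat). sqrt (Re (gram N v a a)))"
  \<comment> \<open>A prescribed Gram matrix bounds every entry of row \<open>a\<close> through its
    diagonal entry, so the box \<open>r\<close> contains all candidates and makes the set
    compact.\<close>
  define S where "S = {f. (\<forall>i\<in>I. cmod (f i) \<le> r i) \<and> (\<forall>i. i \<notin> I \<longrightarrow> f i = 0)} \<inter>
     ((\<Inter>a\<in>{..<d}. \<Inter>b\<in>{..<d}. {f. gram N (?C f) a b = gram N v a b}) \<inter>
      (\<Inter>k\<in>{..<K}. {f. cmod (response d h v k k) \<le> cmod (response d h (?C f) k k)}))"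
  have bound: "cmod (w a j) \<le> sqrt (Re (gram N w a a))" if "j < N" for w :: "nat \<Rightarrow> nat \<Rightarrow> complex" and a j
  proof (rule real_le_rsqrt)
    have "gram N w a a = complex_of_real (\<Sum>j<N. (cmod (w a j))\<^sup>2)"
      unfolding gram_def of_real_sum by (simp only: cnj_mult_self[symmetric] mult.commute)
    then have "Re (gram N w a a) = (\<Sum>j<N. (cmod (w a j))\<^sup>2)" by simp
    moreover have "(cmod (w a j))\<^sup>2 \<le> (\<Sum>j<N. (cmod (w a j))\<^sup>2)"
      using that by (intro member_le_sum) auto
    ultimately show "(cmod (w a j))\<^sup>2 \<le> Re (gram N w a a)" by simp
  qed
  \<comment> \<open>Cutting entries outside the \<open>d x N\<close> range to zero puts a candidate
    into \<open>S\<close> without affecting its Gram entries there or its useful responses.\<close>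
  have in_S: "(\<lambda>(a, j). if a < d \<and> j < N then w a j else 0) \<in> S"
    if g: "\<And>a b. a < d \<Longrightarrow> b < d \<Longrightarrow> gram N w a b = gram N v a b"
      and p: "\<And>k. k < K \<Longrightarrow> cmod (response d h v k k) \<le> cmod (response d h w k k)" for w
  proof -
    let ?f = "\<lambda>(a, j). if a < d \<and> j < N then w a j else 0"
    have "gram N (?C ?f) a b = gram N v a b" if "a < d" "b < d" for a b
      using g[OF that] that by (simp add: gram_def)
    moreover have "response d h (?C ?f) k k = response d h w k k" if "k < K" for k
      using that assms by (simp add: response_def)
    moreover have "cmod (?f i) \<le> r i" if "i \<in> I" for i
      using that bound[of "snd i" w "fst i"] g by (auto simp: I_def r_def)
    ultimately show ?thesis using p by (auto simp: S_def I_def)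
  qed
  have "S \<noteq> {}" using in_S[of v] by auto
  have cont: "continuous_on A (\<lambda>f. gram N (?C f) a b)" "continuous_on A (\<lambda>f. response d h (?C f) k j)" for A a b k j
    unfolding gram_def response_def by (intro continuous_intros continuous_on_coordinate)+
  have "compact S"
    unfolding S_def
    by (intro compact_Int_closed compact_bounded_support closed_Int closed_INT ballI
        closed_Collect_eq closed_Collect_le cont continuous_intros)
  have "continuous_on S (\<lambda>f. \<Sum>k<K. (cmod (response d h (?C f) k k))\<^sup>2)"
    by (intro continuous_intros cont)
  from continuous_attains_sup[OF \<open>compact S\<close> \<open>S \<noteq> {}\<close> this]
  obtain f where f: "f \<in> S"
    and max: "\<And>g. g \<in> S \<Longrightarrow> (\<Sum>k<K. (cmod (response d h (?C g) k k))\<^sup>2) \<le> (\<Sum>k<K. (cmod (response d h (?C f) k k))\<^sup>2)"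
    by blast
  have fg: "gram N (?C f) a b = gram N v a b" if "a < d" "b < d" for a b
    using f that by (auto simp: S_def)
  have fp: "cmod (response d h v k k) \<le> cmod (response d h (?C f) k k)" if "k < K" for k
    using f that by (auto simp: S_def)
  have "response d h (?C f) k j = 0" if kj: "k < K" "K \<le> j" "j < N" for k j
  proof (rule ccontr)
    let ?x = "response d h (?C f) k k" and ?y = "response d h (?C f) k j"
    assume y: "?y \<noteq> 0"
    have "k < N" "k \<noteq> j" using kj by auto
    \<comment> \<open>With the two responses as weights, the useful response of user
      \<open>k\<close> becomes \<open>sqrt ((cmod ?x)\<^sup>2 + (cmod ?y)\<^sup>2)\<close>, a strict
      gain since \<open>?y\<close> is nonzero.\<close>
    from rotate_columns[OF this(1) kj(3) this(2) y, of "?C f" ?x] obtain w where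
      w: "\<And>a b. gram N w a b = gram N (?C f) a b"
        "\<And>a. w a k = (cnj ?x * f (a, k) + cnj ?y * f (a, j)) / of_real (sqrt ((cmod ?x)\<^sup>2 + (cmod ?y)\<^sup>2))"
        "\<And>a c. c \<noteq> k \<Longrightarrow> c \<noteq> j \<Longrightarrow> w a c = f (a, c)"
      by blast
    let ?r = "sqrt ((cmod ?x)\<^sup>2 + (cmod ?y)\<^sup>2)"
    have r2: "?r * ?r = (cmod ?x)\<^sup>2 + (cmod ?y)\<^sup>2" by simp
    have lin: "(\<Sum>a<d. (p * f a + q * g a) / c) = (p * (\<Sum>a<d. f a) + q * (\<Sum>a<d. g a)) / c"
      for p q c :: complex and f g
      by (simp only: sum_divide_distrib[symmetric] sum.distrib sum_distrib_left[symmetric])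
    have square_div: "c * c / c = c" for c :: complex by simp
    have rx: "(\<Sum>a<d. f (a, i) * cnj (h k a)) = response d h (?C f) k i" for i
      by (simp only: response_def)
    have "response d h w k k = (cnj ?x * ?x + cnj ?y * ?y) / of_real ?r"
    proof -
      have "response d h w k k = (\<Sum>a<d. (cnj ?x * (f (a, k) * cnj (h k a)) + cnj ?y * (f (a, j) * cnj (h k a))) / of_real ?r)"
        unfolding response_def[of d h w] w(2) by (intro sum.cong refl) (simp add: algebra_simps)
      also have "\<dots> = (cnj ?x * ?x + cnj ?y * ?y) / of_real ?r"
        by (simp only: lin rx)
      finally show ?thesis .
    qed
    also have "cnj ?x * ?x + cnj ?y * ?y = of_real (?r * ?r)"
      unfolding r2 by (simp only: cnj_mult_self of_real_add)
    finally have "response d h w k k = of_real ?r" by (simp only: of_real_mult square_div)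
    then have new: "(cmod (response d h w k k))\<^sup>2 = (cmod ?x)\<^sup>2 + (cmod ?y)\<^sup>2"
      by simp
    \<comment> \<open>The other useful signals use columns below \<open>K\<close> other than
      \<open>k\<close>, which the rotation does not touch because \<open>K \<le> j\<close>.\<close>
    have old: "response d h w i i = response d h (?C f) i i" if "i < K" "i \<noteq> k" for i
      using that w(3)[of i] kj by (simp add: response_def)
    have "cmod (response d h v i i) \<le> cmod (response d h w i i)" if "i < K" for i
    proof (cases "i = k")
      case True
      have "(cmod ?x)\<^sup>2 \<le> (cmod (response d h w k k))\<^sup>2" unfolding new by simp
      then have "cmod ?x \<le> cmod (response d h w k k)" by (rule power2_le_imp_le) simp
      then show ?thesis using fp[OF kj(1)] True by simp
    qed (use old[OF that] fp[OF that] in simp)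
    then have "(\<lambda>(a, j). if a < d \<and> j < N then w a j else 0) \<in> S"
      by (intro in_S) (use w(1) fg in auto)
    from max[OF this] have "(\<Sum>i<K. (cmod (response d h w i i))\<^sup>2) \<le> (\<Sum>i<K. (cmod (response d h (?C f) i i))\<^sup>2)"
      using assms by (simp add: response_def)
    moreover have "(\<Sum>i<K. (cmod (response d h (?C f) i i))\<^sup>2) < (\<Sum>i<K. (cmod (response d h w i i))\<^sup>2)"
    proof (rule sum_strict_mono_ex1)
      show "\<forall>i\<in>{..<K}. (cmod (response d h (?C f) i i))\<^sup>2 \<le> (cmod (response d h w i i))\<^sup>2"
        using old new by (metis le_add_same_cancel1 lessThan_iff order_refl zero_le_power2)
      show "\<exists>i\<in>{..<K}. (cmod (response d h (?C f) i i))\<^sup>2 < (cmod (response d h w i i))\<^sup>2"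
        using kj y by (intro bexI[of _ k]) (simp_all add: new)
    qed simp
    ultimately show False by simp
  qed
  with fg fp show ?thesis by (rule that)
qed

text \<open>Reindexing for the deletion of a zero column: the last index \<open>n\<close> moves into
  slot \<open>c\<close>. For \<open>c = n\<close> the last summand is itself the zero one.\<close>

lemma sum_skip_zero:
  fixes g :: "nat \<Rightarrow> 'a::comm_monoid_add"
  assumes "c < Suc n" "g c = 0"
  shows "(\<Sum>i<n. g (if i = c then n else i)) = (\<Sum>i<Suc n. g i)"
proof (cases "c = n")
  case True
  then show ?thesis using assms by simp
next
  case False
  then have c: "c \<in> {..<n}" using assms by simp
  have "(\<Sum>i<n. g (if i = c then n else i)) = g n + (\<Sum>i\<in>{..<n} - {c}. g (if i = c then n else i))"
    using c by (simp add: sum.remove[of _ c])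
  also have "(\<Sum>i\<in>{..<n} - {c}. g (if i = c then n else i)) = (\<Sum>i\<in>{..<n} - {c}. g i)"
    by (rule sum.cong) auto
  also have "\<dots> = (\<Sum>i<n. g i)" using c assms(2) by (simp add: sum.remove[of _ c])
  finally show ?thesis by (simp add: add.commute)
qed

lemma remove_beamformer:
  fixes T :: "'e \<Rightarrow> nat \<Rightarrow> nat \<Rightarrow> complex"
  assumes "K \<le> N" "finite E" "K\<^sup>2 + card E < N\<^sup>2"
    and null: "\<And>k j. k < K \<Longrightarrow> K \<le> j \<Longrightarrow> j < N \<Longrightarrow> response d h v k j = 0"
  obtains n w where "N = Suc n" "K \<le> n"
    and "\<And>e. e \<in> E \<Longrightarrow> Re (\<Sum>a<d. \<Sum>b<d. T e a b * gram n w b a) = Re (\<Sum>a<d. \<Sum>b<d. T e a b * gram N v b a)"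
    and "Re (\<Sum>a<d. gram n w a a) \<le> Re (\<Sum>a<d. gram N v a a)"
    and "\<And>k j. k < K \<Longrightarrow> j < n \<Longrightarrow> response d h w k j = (if j < K then response d h v k j else 0)"
proof -
  \<comment> \<open>\<open>Q e i j\<close> is the coefficient of \<open>D i j\<close> in the
    functional \<open>T e\<close> applied to \<open>V D V^H\<close>, and \<open>shift D\<close> is
    \<open>V D V^H\<close> itself.\<close>
  define Q where "Q e i j = (\<Sum>a<d. \<Sum>b<d. T e a b * (v b i * cnj (v a j)))" for e i j
  define shift where "shift D a b = (\<Sum>i<N. \<Sum>j<N. v a i * D i j * cnj (v b j))" for D a b
  obtain D0 where D0: "hermitian_on {..<N} D0" "\<exists>i<N. \<exists>j<N. D0 i j \<noteq> 0"
    "\<And>i j. i < K \<Longrightarrow> j < K \<Longrightarrow> D0 i j = 0"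
    "\<And>e. e \<in> E \<Longrightarrow> Re (\<Sum>i<N. \<Sum>j<N. D0 i j * Q e i j) = 0"
    by (rule hermitian_solution[OF assms(1-3), of Q]) (rule that)
  define power where "power D = Re (\<Sum>a<d. shift D a a)" for D
  have power_qform: "power D = (\<Sum>a<d. Re (qform {..<N} D (\<lambda>i. cnj (v a i))))" for D
    by (simp add: power_def shift_def qform_def)
  have neg: "qform I (\<lambda>i j. - D i j) z = - qform I D z" for I :: "nat set" and D z
    by (simp add: qform_def sum_negf)
  \<comment> \<open>Choice of sign. If the power of \<open>D0\<close> is nonzero, the sign making it
    negative also makes the form negative at the conjugate of some row of \<open>v\<close>. If it is
    zero, both signs are allowed, and a nonzero Hermitian form is negative somewhere for one of
    them.\<close>
  obtain D z0 where D: "D = D0 \<or> D = (\<lambda>i j. - D0 i j)" "power D \<le> 0" "Re (qform {..<N} D z0) < 0"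
  proof -
    have power_neg: "power (\<lambda>i j. - D0 i j) = - power D0"
      by (simp add: power_qform neg sum_negf)
    have dir: "\<exists>z. Re (qform {..<N} D z) < 0" if "power D < 0" for D
    proof (rule ccontr)
      assume "\<not> ?thesis"
      then have "0 \<le> power D" unfolding power_qform by (intro sum_nonneg) (metis not_less)
      with that show False by simp
    qed
    consider "power D0 < 0" | "power D0 > 0" | "power D0 = 0" by linarith
    then show ?thesis
    proof cases
      case 1
      then show ?thesis using dir[of D0] that by (metis less_imp_le)
    next
      case 2
      then have "power (\<lambda>i j. - D0 i j) < 0" by (simp add: power_neg)
      then show ?thesis using dir that by (metis less_imp_le)
    next
      case 3
      obtain z where z: "Re (qform {..<N} D0 z) \<noteq> 0"
        using hermitian_form_nonzero[OF finite_lessThan D0(1)] D0(2) by auto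
      show ?thesis
      proof (cases "Re (qform {..<N} D0 z) < 0")
        case True
        then show ?thesis using 3 that[of D0 z] by simp
      next
        case False
        then show ?thesis using 3 z that[of "\<lambda>i j. - D0 i j" z] by (simp add: power_neg neg)
      qed
    qed
  qed
  have herm: "hermitian_on {..<N} D" and block: "\<And>i j. i < K \<Longrightarrow> j < K \<Longrightarrow> D i j = 0"
    using D(1) D0(1,3) by (auto simp: hermitian_on_def)
  have orth: "Re (\<Sum>i<N. \<Sum>j<N. D i j * Q e i j) = 0" if "e \<in> E" for e
    using D(1) D0(4)[OF that]
    by (elim disjE) (simp_all only: mult_minus_left sum_negf uminus_complex.simps minus_zero)
  obtain t where t: "0 < t"
    "\<And>z. 0 \<le> Re (qform {..<N} (\<lambda>i j. (if i = j then 1 else 0) + of_real t * D i j) z)"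
    "\<exists>z. (\<exists>i\<in>{..<N}. z i \<noteq> 0) \<and> Re (qform {..<N} (\<lambda>i j. (if i = j then 1 else 0) + of_real t * D i j) z) = 0"
    by (rule indefinite_shift_singular[OF finite_lessThan D(3)]) (rule that)
  define \<Phi> where "\<Phi> i j = (if i = j then 1 else 0) + of_real t * D i j" for i j
  have herm_\<Phi>: "hermitian_on {..<N} \<Phi>"
    using herm by (auto simp: hermitian_on_def \<Phi>_def)
  obtain X where X': "(\<forall>i\<in>{..<N}. \<forall>j\<in>{..<N}. \<Phi> i j = (\<Sum>c\<in>{..<N}. X i c * cnj (X j c))) \<and>
    (\<forall>i\<in>{..<K}. \<forall>c\<in>{..<N}. X i c = (if i = c then 1 else 0)) \<and>
    ((\<exists>z. (\<exists>i\<in>{..<N}. z i \<noteq> 0) \<and> qform {..<N} \<Phi> z = 0) \<longrightarrow> (\<exists>c\<in>{..<N}. \<forall>i\<in>{..<N}. X i c = 0))"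
  proof -
    have 1: "0 \<le> Re (qform {..<N} \<Phi> z)" for z using t(2) unfolding \<Phi>_def .
    have 2: "\<Phi> i j = (if i = j then 1 else 0)" if "i \<in> {..<K}" "j \<in> {..<K}" for i j
      using that block by (simp add: \<Phi>_def)
    have 3: "{..<K} \<subseteq> {..<N}" using assms(1) by auto
    show ?thesis
      by (rule exE[OF psd_factorization[OF finite_lessThan herm_\<Phi> 1 3 2]]) (assumption | rule that)+
  qed
  have sing: "\<exists>z. (\<exists>i\<in>{..<N}. z i \<noteq> 0) \<and> qform {..<N} \<Phi> z = 0"
  proof -
    obtain z where z: "\<exists>i\<in>{..<N}. z i \<noteq> 0" "Re (qform {..<N} \<Phi> z) = 0"
      using t(3) unfolding \<Phi>_def by blast
    moreover have "Im (qform {..<N} \<Phi> z) = 0"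
      using arg_cong[OF cnj_qform[OF herm_\<Phi>, of z], of Im] by simp
    ultimately show ?thesis by (intro exI[of _ z]) (simp add: complex_eq_iff)
  qed
  from X' have X: "\<And>i j. i < N \<Longrightarrow> j < N \<Longrightarrow> \<Phi> i j = (\<Sum>c<N. X i c * cnj (X j c))"
    "\<And>i c. i < K \<Longrightarrow> c < N \<Longrightarrow> X i c = (if i = c then 1 else 0)"
    by simp_all
  from X' sing have "\<exists>c\<in>{..<N}. \<forall>i\<in>{..<N}. X i c = 0" by (elim conjE) (rule mp)
  then obtain c0 where c0: "c0 < N" "\<And>i. i < N \<Longrightarrow> X i c0 = 0" by auto
  \<comment> \<open>Each column of \<open>X\<close> below \<open>K\<close> has a 1 on the diagonal,
    so the zero column belongs to a sensing beamformer.\<close>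
  have "K \<le> c0"
  proof (rule ccontr)
    assume "\<not> K \<le> c0"
    then show False using X(2)[of c0 c0] c0(2)[of c0] c0(1) by simp
  qed
  obtain n where n: "N = Suc n" using c0(1) by (cases N) auto
  have "K \<le> n" using \<open>K \<le> c0\<close> c0(1) n by simp
  \<comment> \<open>\<open>y\<close> is the product \<open>V X\<close>; \<open>w\<close> drops its
    zero column \<open>c0\<close> by moving the last column into that slot.\<close>
  define y where "y a c = (\<Sum>i<N. v a i * X i c)" for a c
  define w where "w a c = y a (if c = c0 then n else c)" for a c
  have gram_w: "gram n w a b = gram N v a b + of_real t * shift D a b" for a b
  proof -
    have "gram n w a b = (\<Sum>c<N. y a c * cnj (y b c))"
      unfolding gram_def w_def n
      by (rule sum_skip_zero[where g = "\<lambda>c. y a c * cnj (y b c)"]) (use c0 n in \<open>simp_all add: y_def\<close>)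
    also have "\<dots> = (\<Sum>c<N. \<Sum>i<N. \<Sum>j<N. v a i * (X i c * cnj (X j c)) * cnj (v b j))"
      by (simp add: y_def sum_product mult_ac)
    also have "\<dots> = (\<Sum>i<N. \<Sum>c<N. \<Sum>j<N. v a i * (X i c * cnj (X j c)) * cnj (v b j))"
      by (rule sum.swap)
    also have "\<dots> = (\<Sum>i<N. \<Sum>j<N. \<Sum>c<N. v a i * (X i c * cnj (X j c)) * cnj (v b j))"
      by (intro sum.cong refl sum.swap)
    also have "\<dots> = (\<Sum>i<N. \<Sum>j<N. v a i * \<Phi> i j * cnj (v b j))"
      by (simp add: X(1) sum_distrib_left sum_distrib_right)
    also have "\<dots> = (\<Sum>i<N. \<Sum>j<N. (if i = j then v a i * cnj (v b j) else 0) + of_real t * (v a i * D i j * cnj (v b j)))"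
      by (intro sum.cong refl) (simp add: \<Phi>_def algebra_simps)
    also have "\<dots> = gram N v a b + of_real t * shift D a b"
      by (simp add: sum.distrib sum_distrib_left gram_def shift_def)
    finally show ?thesis .
  qed
  have "Re (\<Sum>a<d. \<Sum>b<d. T e a b * gram n w b a) = Re (\<Sum>a<d. \<Sum>b<d. T e a b * gram N v b a)" if "e \<in> E" for e
  proof -
    \<comment> \<open>Moving the sums over \<open>i\<close> and \<open>j\<close> outside turns the
      functional of \<open>V D V^H\<close> into the linear equation that \<open>D\<close>
      solves.\<close>
    have "(\<Sum>a<d. \<Sum>b<d. T e a b * shift D b a) = (\<Sum>a<d. \<Sum>b<d. \<Sum>i<N. \<Sum>j<N. D i j * (T e a b * (v b i * cnj (v a j))))"
      by (simp add: shift_def sum_distrib_left mult_ac)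
    also have "\<dots> = (\<Sum>a<d. \<Sum>i<N. \<Sum>b<d. \<Sum>j<N. D i j * (T e a b * (v b i * cnj (v a j))))"
      by (intro sum.cong refl sum.swap)
    also have "\<dots> = (\<Sum>i<N. \<Sum>a<d. \<Sum>b<d. \<Sum>j<N. D i j * (T e a b * (v b i * cnj (v a j))))"
      by (rule sum.swap)
    also have "\<dots> = (\<Sum>i<N. \<Sum>a<d. \<Sum>j<N. \<Sum>b<d. D i j * (T e a b * (v b i * cnj (v a j))))"
      by (intro sum.cong refl sum.swap)
    also have "\<dots> = (\<Sum>i<N. \<Sum>j<N. \<Sum>a<d. \<Sum>b<d. D i j * (T e a b * (v b i * cnj (v a j))))"
      by (intro sum.cong refl sum.swap)
    also have "\<dots> = (\<Sum>i<N. \<Sum>j<N. D i j * Q e i j)"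
      by (simp add: Q_def sum_distrib_left)
    finally have "Re (\<Sum>a<d. \<Sum>b<d. T e a b * shift D b a) = 0" using orth[OF that] by simp
    moreover have "(\<Sum>a<d. \<Sum>b<d. T e a b * gram n w b a) = (\<Sum>a<d. \<Sum>b<d. T e a b * gram N v b a)
        + of_real t * (\<Sum>a<d. \<Sum>b<d. T e a b * shift D b a)"
      by (simp add: gram_w ring_distribs sum.distrib sum_distrib_left mult_ac)
    ultimately show ?thesis by simp
  qed
  moreover have "Re (\<Sum>a<d. gram n w a a) \<le> Re (\<Sum>a<d. gram N v a a)"
  proof -
    have "Re (\<Sum>a<d. gram n w a a) = Re (\<Sum>a<d. gram N v a a) + t * power D"
      by (simp add: gram_w power_def sum.distrib sum_distrib_left)
    moreover have "t * power D \<le> 0" using t(1) D(2) by (simp add: mult_nonneg_nonpos)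
    ultimately show ?thesis by simp
  qed
  moreover have "response d h w k j = (if j < K then response d h v k j else 0)" if kj: "k < K" "j < n" for k j
  proof -
    define c where "c = (if j = c0 then n else j)"
    have c: "c < N" using kj n by (simp add: c_def)
    have "response d h w k j = (\<Sum>a<d. \<Sum>i<N. v a i * X i c * cnj (h k a))"
      by (simp add: response_def w_def y_def c_def sum_distrib_right)
    also have "\<dots> = (\<Sum>i<N. \<Sum>a<d. v a i * X i c * cnj (h k a))"
      by (rule sum.swap)
    also have "\<dots> = (\<Sum>i<N. response d h v k i * X i c)"
      by (simp add: response_def sum_distrib_left mult_ac)
    \<comment> \<open>Null steering leaves only indices below \<open>K\<close>, where the rows of
      \<open>X\<close> are unit vectors. As \<open>K \<le> c0\<close> and \<open>K \<le> n\<close>,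
      relocating the last column does not disturb the communication columns.\<close>
    also have "\<dots> = (\<Sum>i<K. response d h v k i * X i c)"
      by (rule sum.mono_neutral_right) (use assms(1) null[OF kj(1)] in auto)
    also have "\<dots> = (\<Sum>i<K. if i = c then response d h v k i else 0)"
      by (rule sum.cong) (simp_all add: X(2) c)
    also have "\<dots> = (if j < K then response d h v k j else 0)"
      using \<open>K \<le> c0\<close> \<open>K \<le> n\<close> by (auto simp: c_def)
    finally show ?thesis .
  qed
  ultimately show ?thesis using that n \<open>K \<le> n\<close> by blast
qed

text \<open>Induction on \<open>N\<close>: while \<open>N^2\<close> exceeds the bound, null steering
  followed by \<open>remove_beamformer\<close> saves one column without going below
  \<open>K\<close>.\<close>

lemma fewer_beamformers:
  fixes T :: "'e \<Rightarrow> nat \<Rightarrow> nat \<Rightarrow> complex"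
  assumes "finite E" "0 < s" "K \<le> N"
  shows "\<exists>n w. K \<le> n \<and> n\<^sup>2 \<le> K\<^sup>2 + card E \<and>
    (\<forall>e\<in>E. Re (\<Sum>a<d. \<Sum>b<d. T e a b * gram n w b a) = Re (\<Sum>a<d. \<Sum>b<d. T e a b * gram N v b a)) \<and>
    Re (\<Sum>a<d. gram n w a a) \<le> Re (\<Sum>a<d. gram N v a a) \<and>
    (\<forall>k<K. sinr d h s N v k \<le> sinr d h s n w k)"
  using assms(3)
proof (induction N arbitrary: v rule: less_induct)
  case (less N)
  show ?case
  proof (cases "N\<^sup>2 \<le> K\<^sup>2 + card E")
    case True
    then show ?thesis using less.prems by (intro exI[of _ N] exI[of _ v]) auto
  next
    case False
    then have big: "K\<^sup>2 + card E < N\<^sup>2" by simp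
    obtain u where u: "\<And>a b. a < d \<Longrightarrow> b < d \<Longrightarrow> gram N u a b = gram N v a b"
      "\<And>k. k < K \<Longrightarrow> cmod (response d h v k k) \<le> cmod (response d h u k k)"
      "\<And>k j. k < K \<Longrightarrow> K \<le> j \<Longrightarrow> j < N \<Longrightarrow> response d h u k j = 0"
      by (rule exists_null_steered_sensing[OF less.prems, of d v h]) (rule that)
    obtain m y where y: "N = Suc m" "K \<le> m"
      "\<And>e. e \<in> E \<Longrightarrow> Re (\<Sum>a<d. \<Sum>b<d. T e a b * gram m y b a) = Re (\<Sum>a<d. \<Sum>b<d. T e a b * gram N u b a)"
      "Re (\<Sum>a<d. gram m y a a) \<le> Re (\<Sum>a<d. gram N u a a)"
      "\<And>k j. k < K \<Longrightarrow> j < m \<Longrightarrow> response d h y k j = (if j < K then response d h u k j else 0)"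
      by (rule remove_beamformer[OF less.prems assms(1) big u(3), where T = T]) (assumption | rule that)+
    obtain n w where w: "K \<le> n" "n\<^sup>2 \<le> K\<^sup>2 + card E"
      "\<And>e. e \<in> E \<Longrightarrow> Re (\<Sum>a<d. \<Sum>b<d. T e a b * gram n w b a) = Re (\<Sum>a<d. \<Sum>b<d. T e a b * gram m y b a)"
      "Re (\<Sum>a<d. gram n w a a) \<le> Re (\<Sum>a<d. gram m y a a)"
      "\<And>k. k < K \<Longrightarrow> sinr d h s m y k \<le> sinr d h s n w k"
      using less.IH[OF _ y(2), of y] y(1) by auto
    \<comment> \<open>Null steering keeps the total received power, so any gain in useful signal is
      taken from the interference.\<close>
    have "sinr d h s N v k \<le> sinr d h s N u k" if "k < K" for k
    proof -
      have split: "(\<Sum>j<N. f j) = f k + (\<Sum>j\<in>{..<N} - {k}. f j)" for f :: "nat \<Rightarrow> real"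
        using that less.prems by (intro sum.remove) auto
      have "(\<Sum>j<N. (cmod (response d h v k j))\<^sup>2) = (\<Sum>j<N. (cmod (response d h u k j))\<^sup>2)"
        by (rule response_power_cong) (simp add: u(1))
      moreover have p: "(cmod (response d h v k k))\<^sup>2 \<le> (cmod (response d h u k k))\<^sup>2"
        using u(2)[OF that] by (simp add: power_mono)
      ultimately have "(\<Sum>j\<in>{..<N} - {k}. (cmod (response d h u k j))\<^sup>2) \<le> (\<Sum>j\<in>{..<N} - {k}. (cmod (response d h v k j))\<^sup>2)"
        unfolding split by linarith
      moreover have "0 \<le> (\<Sum>j\<in>{..<N} - {k}. (cmod (response d h u k j))\<^sup>2)"
        by (simp add: sum_nonneg)
      ultimately show ?thesis unfolding sinr_def
        using p assms(2) by (intro frac_le) auto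
    qed
    \<comment> \<open>Before and after the removal only the first \<open>K\<close> columns reach
      user \<open>k\<close>, with the same responses.\<close>
    moreover have "sinr d h s m y k = sinr d h s N u k" if "k < K" for k
    proof -
      have "(\<Sum>j\<in>{..<m} - {k}. (cmod (response d h y k j))\<^sup>2) = (\<Sum>j\<in>{..<K} - {k}. (cmod (response d h u k j))\<^sup>2)"
        by (rule sum.mono_neutral_cong_right) (use y(2,5) that in auto)
      moreover have "(\<Sum>j\<in>{..<N} - {k}. (cmod (response d h u k j))\<^sup>2) = (\<Sum>j\<in>{..<K} - {k}. (cmod (response d h u k j))\<^sup>2)"
        by (rule sum.mono_neutral_right) (use less.prems u(3)[OF that] in \<open>auto simp: not_less[symmetric]\<close>)
      ultimately show ?thesis using y(2,5) that by (simp add: sinr_def)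
    qed
    ultimately have "sinr d h s N v k \<le> sinr d h s n w k" if "k < K" for k
      using w(5) that by (metis order_trans)
    with w y u(1) show ?thesis by (intro exI[of _ n] exI[of _ w]) (auto intro: order_trans)
  qed
qed

subsection \<open>Transfer to complex matrices\<close>

lemma dim_mat_adjoint [simp]: "dim_row (mat_adjoint A) = dim_col A" "dim_col (mat_adjoint A) = dim_row A"
  by (simp_all add: mat_adjoint_def)

lemma index_mat_adjoint:
  "i < dim_col A \<Longrightarrow> j < dim_row A \<Longrightarrow> mat_adjoint A $$ (i, j) = conjugate (A $$ (j, i))"
  by (simp add: mat_adjoint_def mat_of_rows_index)

lemma index_gram_mat:
  assumes "V \<in> carrier_mat d N" "a < d" "b < d"
  shows "(V * mat_adjoint V) $$ (a, b) = gram N (\<lambda>a j. V $$ (a, j)) a b"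
  using assms
  by (auto simp: scalar_prod_def gram_def index_mat_adjoint conjugate_complex_def lessThan_atLeast0
      intro!: sum.cong)

lemma ctrace_gram:
  assumes "V \<in> carrier_mat d N"
  shows "ctrace (V * mat_adjoint V) = (\<Sum>a<d. gram N (\<lambda>a j. V $$ (a, j)) a a)"
proof -
  have "dim_row (V * mat_adjoint V) = d" using assms by simp
  then show ?thesis unfolding ctrace_def using index_gram_mat[OF assms] by (intro sum.cong) auto
qed

lemma ctrace_mult_gram:
  assumes "V \<in> carrier_mat d N" "T \<in> carrier_mat d d"
  shows "ctrace (T * (V * mat_adjoint V)) =
    (\<Sum>a<d. \<Sum>b<d. T $$ (a, b) * gram N (\<lambda>a j. V $$ (a, j)) b a)"
proof -
  have dims: "dim_row T = d" "dim_col T = d" "dim_row V = d" "dim_col V = N" using assms by auto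
  have "(T * (V * mat_adjoint V)) $$ (a, a) = (\<Sum>b<d. T $$ (a, b) * gram N (\<lambda>a j. V $$ (a, j)) b a)"
    if "a < d" for a
  proof -
    have "(T * (V * mat_adjoint V)) $$ (a, a) = (\<Sum>b<d. T $$ (a, b) * (V * mat_adjoint V) $$ (b, a))"
      using that dims by (simp add: scalar_prod_def lessThan_atLeast0)
    also have "\<dots> = (\<Sum>b<d. T $$ (a, b) * gram N (\<lambda>a j. V $$ (a, j)) b a)"
      by (intro sum.cong refl) (simp only: index_gram_mat[OF assms(1)] that lessThan_iff)
    finally show ?thesis .
  qed
  then show ?thesis using dims by (simp add: ctrace_def)
qed

lemma col_inner_channel:
  assumes "V \<in> carrier_mat d N" "j < N" "h k \<in> carrier_vec d"
  shows "col V j \<bullet>c h k = response d (\<lambda>k a. h k $ a) (\<lambda>a j. V $$ (a, j)) k j"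
  using assms
  by (auto simp: scalar_prod_def response_def conjugate_complex_def lessThan_atLeast0 intro!: sum.cong)

lemma inner_gram_channel:
  assumes "V \<in> carrier_mat d N" "h k \<in> carrier_vec d"
  shows "Re (((V * mat_adjoint V) *\<^sub>v h k) \<bullet>c h k) =
    (\<Sum>j<N. (cmod (response d (\<lambda>k a. h k $ a) (\<lambda>a j. V $$ (a, j)) k j))\<^sup>2)"
proof -
  have dims: "dim_row V = d" "dim_col V = N" "dim_vec (h k) = d" using assms by auto
  have "((V * mat_adjoint V) *\<^sub>v h k) \<bullet>c h k =
      (\<Sum>a<d. (\<Sum>b<d. (V * mat_adjoint V) $$ (a, b) * h k $ b) * cnj (h k $ a))"
    using dims by (simp add: scalar_prod_def conjugate_complex_def lessThan_atLeast0)
  also have "\<dots> = (\<Sum>a<d. (\<Sum>b<d. gram N (\<lambda>a j. V $$ (a, j)) a b * h k $ b) * cnj (h k $ a))"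
    by (intro sum.cong refl arg_cong2[where f = "(*)"]) (simp_all add: index_gram_mat[OF assms(1)])
  also have "\<dots> = (\<Sum>a<d. \<Sum>b<d. cnj (h k $ a) * gram N (\<lambda>a j. V $$ (a, j)) a b * h k $ b)"
    by (simp add: sum_distrib_left mult_ac)
  finally show ?thesis unfolding response_power by simp
qed

text \<open>The interference of \<open>sinr_NIC\<close> splits the columns at \<open>K\<close>;
  sensing column \<open>j\<close> has index \<open>j + K\<close> in the whole matrix.\<close>

lemma sinr_NIC_eq_sinr:
  assumes "V \<in> carrier_mat d N" "k < K" "K \<le> N" "h k \<in> carrier_vec d"
  shows "sinr_NIC K s h V k = sinr d (\<lambda>k a. h k $ a) s N (\<lambda>a j. V $$ (a, j)) k"
proof -
  let ?r = "response d (\<lambda>k a. h k $ a) (\<lambda>a j. V $$ (a, j)) k"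
  have S: "sensing_part K V \<in> carrier_mat d (N - K)"
    using assms by (auto simp: sensing_part_def)
  have "Re (((sensing_part K V * mat_adjoint (sensing_part K V)) *\<^sub>v h k) \<bullet>c h k) =
     (\<Sum>j<N - K. (cmod (?r (j + K)))\<^sup>2)"
    unfolding inner_gram_channel[where h = h and k = k, OF S assms(4)] using assms
    by (intro sum.cong refl arg_cong[where f = "\<lambda>x. (cmod x)\<^sup>2"])
      (auto simp: response_def sensing_part_def)
  also have "\<dots> = (\<Sum>j\<in>{K..<N}. (cmod (?r j))\<^sup>2)"
    using sum.shift_bounds_nat_ivl[of "\<lambda>j. (cmod (?r j))\<^sup>2" 0 K "N - K"] assms(3)
    by (simp add: lessThan_atLeast0)
  finally have sensing: "Re (((sensing_part K V * mat_adjoint (sensing_part K V)) *\<^sub>v h k) \<bullet>c h k) =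
     (\<Sum>j\<in>{K..<N}. (cmod (?r j))\<^sup>2)" .
  have "{..<N} - {k} = ({..<K} - {k}) \<union> {K..<N}" using assms(2,3) by auto
  moreover have "({..<K} - {k}) \<inter> {K..<N} = {}" by auto
  ultimately have "(\<Sum>j\<in>{..<N} - {k}. (cmod (?r j))\<^sup>2) =
      (\<Sum>j\<in>{..<K} - {k}. (cmod (?r j))\<^sup>2) + (\<Sum>j\<in>{K..<N}. (cmod (?r j))\<^sup>2)"
    by (simp add: sum.union_disjoint)
  moreover have "(\<Sum>j\<in>{..<K} - {k}. (cmod (col V j \<bullet>c h k))\<^sup>2) = (\<Sum>j\<in>{..<K} - {k}. (cmod (?r j))\<^sup>2)"
    using assms by (intro sum.cong refl) (simp add: col_inner_channel[OF assms(1)])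
  moreover have "col V k \<bullet>c h k = ?r k"
    using assms by (intro col_inner_channel[OF assms(1)]) auto
  ultimately show ?thesis unfolding sinr_NIC_def sinr_def sensing by simp
qed

text \<open>This symmetry is what reduces the \<open>L^2\<close> entries of the data part to
  \<open>L (L + 1) / 2\<close> equations.\<close>

lemma G_tilde_commute: "G_tilde M \<eta> NR NT G i j = G_tilde M \<eta> NR NT G j i"
proof -
  have "G_cross NR NT G i j x = G_cross NR NT G j i x" for x
    unfolding G_cross_def
    by (rule comm_add_mat[of _ NT NT]) (rule carrier_matI; simp add: G_dot_def)+
  then show ?thesis by (simp add: G_tilde_def)
qed

lemma data_info_entry:
  assumes "V \<in> carrier_mat NT N"
  shows "vec_nth (vec_nth (data_info M \<eta> NR NT G \<Upsilon> s V) i) j = real \<Upsilon> / s *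
    Re (\<Sum>a<NT. \<Sum>b<NT. G_tilde M \<eta> NR NT G i j $$ (a, b) * gram N (\<lambda>a j. V $$ (a, j)) b a)"
  using ctrace_mult_gram[OF assms, of "G_tilde M \<eta> NR NT G i j"]
  by (simp add: data_info_def G_tilde_def)

lemma bfim_cong:
  assumes "V \<in> carrier_mat NT N" "W \<in> carrier_mat NT n"
    and "\<And>i j. Re (\<Sum>a<NT. \<Sum>b<NT. G_tilde M \<eta> NR NT G i j $$ (a, b) * gram N (\<lambda>a j. V $$ (a, j)) b a)
       = Re (\<Sum>a<NT. \<Sum>b<NT. G_tilde M \<eta> NR NT G i j $$ (a, b) * gram n (\<lambda>a j. W $$ (a, j)) b a)"
  shows "bfim M \<eta> f NR NT G \<Upsilon> s V = bfim M \<eta> f NR NT G \<Upsilon> s W"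
proof -
  have "data_info M \<eta> NR NT G \<Upsilon> s V = data_info M \<eta> NR NT G \<Upsilon> s W"
    unfolding Finite_Cartesian_Product.vec_eq_iff data_info_entry[OF assms(1)] data_info_entry[OF assms(2)] assms(3) by simp
  then show ?thesis by (simp add: bfim_def)
qed

section \<open>Counting independent matrix entries and the square-root bound\<close>

text \<open>One representative per unordered pair, chosen by an injection into the naturals. The
  count is inclusion-exclusion: the relation and its converse cover all pairs and meet in the
  diagonal.\<close>

lemma card_unordered_pairs:
  obtains E :: "('l::finite \<times> 'l) set"
  where "\<And>i j. (i, j) \<in> E \<or> (j, i) \<in> E" "2 * card E = CARD('l) * (CARD('l) + 1)"
proof -
  obtain u :: "'l \<Rightarrow> nat" where u: "inj u"
    using finite_imp_inj_to_nat_seg[of "UNIV :: 'l set"] by auto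
  define E where "E = {(i, j). u i \<le> u j}"
  have "card (E \<union> E\<inverse>) + card (E \<inter> E\<inverse>) = card E + card (E\<inverse>)"
    by (rule card_Un_Int[symmetric]) simp_all
  moreover have "E \<union> E\<inverse> = UNIV \<times> UNIV" by (auto simp: E_def)
  moreover have "E \<inter> E\<inverse> = (\<lambda>i. (i, i)) ` UNIV"
    using u by (auto simp: E_def inj_eq intro: antisym dest: injD[OF u, OF antisym])
  moreover have "card (E\<inverse>) = card E"
    by (simp add: card_inverse)
  moreover have "card ((\<lambda>i::'l. (i, i)) ` UNIV) = CARD('l)"
    by (intro card_image inj_onI) simp
  ultimately have "2 * card E = CARD('l) * (CARD('l) + 1)"
    by (simp add: card_cartesian_product del: UNIV_Times_UNIV)
  then show ?thesis by (intro that[of E]) (auto simp: E_def)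
qed

lemma le_N_bound_NIC:
  assumes "n\<^sup>2 \<le> K\<^sup>2 + c" "2 * c = L * (L + 1)"
  shows "n \<le> N_bound_NIC K L"
proof -
  have "real n ^ 2 \<le> real K ^ 2 + real c"
    using assms(1) by (metis of_nat_add of_nat_le_iff of_nat_power)
  moreover have "real c = real L * (real L + 1) / 2"
    using arg_cong[OF assms(2), of real] by (simp add: field_simps)
  ultimately have "real n \<le> sqrt (real K ^ 2 + real L * (real L + 1) / 2)"
    by (intro real_le_rsqrt) simp
  then show ?thesis
    unfolding N_bound_NIC_def by (simp add: le_nat_floor)
qed

lemma K_le_N_bound_NIC: "K \<le> N_bound_NIC K L"
  by (rule le_N_bound_NIC[of K K "L * (L + 1) div 2"]) simp_all

section \<open>Reduction and padding of beamforming matrices, optimal values\<close>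

context
  fixes M :: "'w measure" and \<eta> :: "'w \<Rightarrow> real^'l" and f :: "real^'l \<Rightarrow> real"
    and NR NT \<Upsilon> K :: nat and G :: "real^'l \<Rightarrow> complex mat" and s :: real
    and h :: "nat \<Rightarrow> complex Matrix.vec"
  assumes s: "0 < s" and channels: "\<And>k. k < K \<Longrightarrow> h k \<in> carrier_vec NT"
begin

text \<open>Applies \<open>fewer_beamformers\<close> with one linear functional per unordered pair
  of parameters and packs the result into a matrix.\<close>

lemma reduce_beamformers:
  assumes V: "V \<in> carrier_mat NT N" and "K \<le> N"
  obtains n W where "K \<le> n" "n \<le> N_bound_NIC K CARD('l)" "W \<in> carrier_mat NT n"
    "bfim M \<eta> f NR NT G \<Upsilon> s W = bfim M \<eta> f NR NT G \<Upsilon> s V"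
    "\<And>k. k < K \<Longrightarrow> sinr_NIC K s h V k \<le> sinr_NIC K s h W k"
    "tx_power W \<le> tx_power V"
proof -
  let ?v = "\<lambda>a j. V $$ (a, j)" and ?h = "\<lambda>k a. h k $ a"
  let ?T = "\<lambda>(i, j) a b. G_tilde M \<eta> NR NT G i j $$ (a, b)"
  obtain E :: "('l \<times> 'l) set"
    where E: "\<And>i j. (i, j) \<in> E \<or> (j, i) \<in> E" "2 * card E = CARD('l) * (CARD('l) + 1)"
    by (rule card_unordered_pairs) (rule that)
  obtain n w where w: "K \<le> n" "n\<^sup>2 \<le> K\<^sup>2 + card E"
    "\<forall>e\<in>E. Re (\<Sum>a<NT. \<Sum>b<NT. ?T e a b * gram n w b a) = Re (\<Sum>a<NT. \<Sum>b<NT. ?T e a b * gram N ?v b a)"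
    "Re (\<Sum>a<NT. gram n w a a) \<le> Re (\<Sum>a<NT. gram N ?v a a)"
    "\<forall>k<K. sinr NT ?h s N ?v k \<le> sinr NT ?h s n w k"
    using fewer_beamformers[OF finite s \<open>K \<le> N\<close>,
        where E = E and d = NT and T = ?T and v = ?v and h = ?h] by blast
  define W where "W = Matrix.mat NT n (\<lambda>(a, j). w a j)"
  have W: "W \<in> carrier_mat NT n" by (simp add: W_def)
  have gram_W: "gram n (\<lambda>a j. W $$ (a, j)) a b = gram n w a b" if "a < NT" "b < NT" for a b
    using that by (simp add: gram_def W_def)
  have "sinr NT ?h s n (\<lambda>a j. W $$ (a, j)) k = sinr NT ?h s n w k" if "k < K" for k
  proof -
    have "response NT ?h (\<lambda>a j. W $$ (a, j)) k j = response NT ?h w k j" if "j < n" for j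
      using that by (simp add: response_def W_def)
    then show ?thesis using that w(1) by (simp add: sinr_def)
  qed
  then have "sinr_NIC K s h V k \<le> sinr_NIC K s h W k" if "k < K" for k
    using that w(1,5) channels \<open>K \<le> N\<close> by (simp add: sinr_NIC_eq_sinr[OF V] sinr_NIC_eq_sinr[OF W])
  moreover have "bfim M \<eta> f NR NT G \<Upsilon> s W = bfim M \<eta> f NR NT G \<Upsilon> s V"
  proof (rule bfim_cong[OF W V])
    fix i j
    have *: "Re (\<Sum>a<NT. \<Sum>b<NT. G_tilde M \<eta> NR NT G i j $$ (a, b) * gram n w b a) =
        Re (\<Sum>a<NT. \<Sum>b<NT. G_tilde M \<eta> NR NT G i j $$ (a, b) * gram N ?v b a)" if "(i, j) \<in> E" for i j
      using bspec[OF w(3) that] by simp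
    \<comment> \<open>\<open>E\<close> contains \<open>(i, j)\<close> or \<open>(j, i)\<close>, and
      both stand for the same equation by symmetry of \<open>G_tilde\<close>.\<close>
    show "Re (\<Sum>a<NT. \<Sum>b<NT. G_tilde M \<eta> NR NT G i j $$ (a, b) * gram n (\<lambda>a j. W $$ (a, j)) b a) =
        Re (\<Sum>a<NT. \<Sum>b<NT. G_tilde M \<eta> NR NT G i j $$ (a, b) * gram N ?v b a)"
      using E(1)[of i j] *[of i j] *[of j i] G_tilde_commute[of M \<eta> NR NT G i j]
      by (auto simp: gram_W simp del: Re_sum)
  qed
  moreover have "tx_power W \<le> tx_power V"
    using w(4) by (simp add: tx_power_def ctrace_gram[OF V] ctrace_gram[OF W] gram_W del: Re_sum)
  ultimately show ?thesis
    using that w(1) W le_N_bound_NIC[OF w(2) E(2)] by blast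
qed

text \<open>Appended zero columns are silent sensing beamformers. This makes problems with different
  numbers of columns comparable.\<close>

lemma pad_beamformers:
  assumes V: "V \<in> carrier_mat NT n" and "K \<le> n" "n \<le> N"
  obtains W where "W \<in> carrier_mat NT N"
    "bfim M \<eta> f NR NT G \<Upsilon> s W = bfim M \<eta> f NR NT G \<Upsilon> s V"
    "\<And>k. k < K \<Longrightarrow> sinr_NIC K s h W k = sinr_NIC K s h V k"
    "tx_power W = tx_power V"
proof -
  let ?v = "\<lambda>a j. V $$ (a, j)" and ?h = "\<lambda>k a. h k $ a"
  define W where "W = Matrix.mat NT N (\<lambda>(a, j). if j < n then V $$ (a, j) else 0)"
  let ?w = "\<lambda>a j. W $$ (a, j)"
  have W: "W \<in> carrier_mat NT N" by (simp add: W_def)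
  have gram_W: "gram N ?w a b = gram n ?v a b" if "a < NT" "b < NT" for a b
    unfolding gram_def using \<open>n \<le> N\<close> that
    by (intro sum.mono_neutral_cong_right) (auto simp: W_def)
  have response_W: "response NT ?h ?w k j = (if j < n then response NT ?h ?v k j else 0)" if "j < N" for k j
    using that by (simp add: response_def W_def)
  have "sinr_NIC K s h W k = sinr_NIC K s h V k" if "k < K" for k
  proof -
    have "(\<Sum>j\<in>{..<N} - {k}. (cmod (response NT ?h ?w k j))\<^sup>2) = (\<Sum>j\<in>{..<n} - {k}. (cmod (response NT ?h ?v k j))\<^sup>2)"
      using \<open>n \<le> N\<close> by (intro sum.mono_neutral_cong_right) (auto simp: response_W)
    then have "sinr NT ?h s N ?w k = sinr NT ?h s n ?v k"
      using that assms by (simp add: sinr_def response_W)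
    then show ?thesis using that channels assms by (simp add: sinr_NIC_eq_sinr[OF V] sinr_NIC_eq_sinr[OF W])
  qed
  moreover have "bfim M \<eta> f NR NT G \<Upsilon> s W = bfim M \<eta> f NR NT G \<Upsilon> s V"
    by (rule bfim_cong[OF W V]) (simp add: gram_W del: Re_sum)
  moreover have "tx_power W = tx_power V"
    by (simp add: tx_power_def ctrace_gram[OF V] ctrace_gram[OF W] gram_W)
  ultimately show ?thesis using that W by blast
qed

text \<open>Each feasible point of one problem has a counterpart in the other with the same
  information matrix, hence the same objective value: padding in one direction, reduction in the
  other.\<close>

lemma opt_value_NIC_bound:
  assumes "N_bound_NIC K CARD('l) \<le> N"
  shows "opt_value_NIC \<phi> (bfim M \<eta> f NR NT G \<Upsilon> s) NT K s h P \<gamma> (N_bound_NIC K CARD('l)) =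
    opt_value_NIC \<phi> (bfim M \<eta> f NR NT G \<Upsilon> s) NT K s h P \<gamma> N"
  unfolding opt_value_NIC_def
proof (rule INF_eq)
  let ?B = "N_bound_NIC K CARD('l)" and ?J = "bfim M \<eta> f NR NT G \<Upsilon> s"
  have "K \<le> ?B" by (rule K_le_N_bound_NIC)
  fix V
  {
    assume "V \<in> {V \<in> feasible_NIC NT K s h P \<gamma> ?B. invertible (?J V)}"
    then have V: "V \<in> carrier_mat NT ?B" "\<And>k. k < K \<Longrightarrow> \<gamma> $ k \<le> sinr_NIC K s h V k"
      "tx_power V \<le> P" "invertible (?J V)" by (auto simp: feasible_NIC_def)
    obtain W where "W \<in> carrier_mat NT N" "?J W = ?J V"
      "\<And>k. k < K \<Longrightarrow> sinr_NIC K s h W k = sinr_NIC K s h V k" "tx_power W = tx_power V"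
      by (rule pad_beamformers[OF V(1) \<open>K \<le> ?B\<close> assms]) (rule that)
    with V show "\<exists>W\<in>{V \<in> feasible_NIC NT K s h P \<gamma> N. invertible (?J V)}.
        ereal (\<phi> (matrix_inv (?J W))) \<le> ereal (\<phi> (matrix_inv (?J V)))"
      by (intro bexI[of _ W]) (simp_all add: feasible_NIC_def)
  next
    assume "V \<in> {V \<in> feasible_NIC NT K s h P \<gamma> N. invertible (?J V)}"
    then have V: "V \<in> carrier_mat NT N" "\<And>k. k < K \<Longrightarrow> \<gamma> $ k \<le> sinr_NIC K s h V k"
      "tx_power V \<le> P" "invertible (?J V)" by (auto simp: feasible_NIC_def)
    have "K \<le> N" using \<open>K \<le> ?B\<close> assms by simp
    obtain n U where U: "K \<le> n" "n \<le> ?B" "U \<in> carrier_mat NT n" "?J U = ?J V"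
      "\<And>k. k < K \<Longrightarrow> sinr_NIC K s h V k \<le> sinr_NIC K s h U k" "tx_power U \<le> tx_power V"
      by (rule reduce_beamformers[OF V(1) \<open>K \<le> N\<close>]) (rule that)
    \<comment> \<open>The reduction may end below the bound, so zero columns restore exactly
      \<open>?B\<close> of them.\<close>
    obtain W where W: "W \<in> carrier_mat NT ?B" "?J W = ?J U"
      "\<And>k. k < K \<Longrightarrow> sinr_NIC K s h W k = sinr_NIC K s h U k" "tx_power W = tx_power U"
      by (rule pad_beamformers[OF U(3,1,2)]) (rule that)
    have "\<gamma> $ k \<le> sinr_NIC K s h W k" if "k < K" for k
      using V(2)[OF that] U(5)[OF that] W(3)[OF that] by simp
    with V U W show "\<exists>W\<in>{V \<in> feasible_NIC NT K s h P \<gamma> ?B. invertible (?J V)}.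
        ereal (\<phi> (matrix_inv (?J W))) \<le> ereal (\<phi> (matrix_inv (?J V)))"
      by (intro bexI[of _ W]) (simp_all add: feasible_NIC_def)
  }
qed

lemma N_min_NIC_le_bound: "N_min_NIC \<phi> (bfim M \<eta> f NR NT G \<Upsilon> s) NT K s h P \<gamma> \<le> N_bound_NIC K CARD('l)"
proof (cases "N_bound_NIC K CARD('l) \<le> NT + K")
  case True
  then show ?thesis
    unfolding N_min_NIC_def
    by (intro Least_le conjI K_le_N_bound_NIC opt_value_NIC_bound)
next
  \<comment> \<open>If the bound exceeds \<open>NT + K\<close>, then \<open>NT + K\<close> itself is
    a candidate for the minimum and lies below the bound.\<close>
  case False
  have "N_min_NIC \<phi> (bfim M \<eta> f NR NT G \<Upsilon> s) NT K s h P \<gamma> \<le> NT + K"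
    unfolding N_min_NIC_def by (intro Least_le) simp
  with False show ?thesis by simp
qed

end

theorem theorem2:
  fixes NT NR K \<Upsilon> :: nat
    and \<sigma>2 P :: real
    and h :: "nat \<Rightarrow> complex Matrix.vec"
    and M :: "'w measure"
    and \<eta> :: "'w \<Rightarrow> real^'l"
    and f :: "real^'l \<Rightarrow> real"
    and G :: "real^'l \<Rightarrow> complex mat"
  assumes "NT \<ge> 1" and "NR \<ge> 1" and "\<Upsilon> \<ge> 1"
    and "\<sigma>2 > 0" and "P > 0"
    and channels: "\<And>k. k < K \<Longrightarrow> h k \<in> carrier_vec NT"
    and "prob_space M"
    and "\<And>x. 0 \<le> f x"
    and prior: "distributed M lborel \<eta> (\<lambda>x. ennreal (f x))"
    and log_prior: "AE \<omega> in M. log_twice_partial_differentiable f (\<eta> \<omega>)"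
    and G_carrier: "\<And>x. G x \<in> carrier_mat NR NT"
    and G_diff: "\<And>x r c. r < NR \<Longrightarrow> c < NT \<Longrightarrow> (\<lambda>y. G y $$ (r, c)) differentiable (at x)"
    and prior_integrable: "\<And>i j. integrable M (\<lambda>\<omega>. log_hessian f i j (\<eta> \<omega>))"
    and data_integrable: "\<And>i j a b. a < NT \<Longrightarrow> b < NT \<Longrightarrow>
           integrable M (\<lambda>\<omega>. G_cross NR NT G i j (\<eta> \<omega>) $$ (a, b))"
    and prior_psd: "psd (prior_info M \<eta> f)"
  shows
    "(\<forall>(J, \<gamma>) \<in> achievable_NIC (bfim M \<eta> f NR NT G \<Upsilon> \<sigma>2) NT K \<sigma>2 h P.
        (\<forall>k<K. 0 < \<gamma> $ k) \<longrightarrow>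
        (\<exists>N'. K \<le> N' \<and> N' \<le> N_bound_NIC K CARD('l) \<and>
          (\<exists>V' \<in> carrier_mat NT N'.
             bfim M \<eta> f NR NT G \<Upsilon> \<sigma>2 V' = J \<and>
             (\<forall>k<K. \<gamma> $ k \<le> vsinr_NIC K \<sigma>2 h V' $ k) \<and>
             tx_power V' \<le> P)))
     \<and>
     (\<forall>(\<phi> :: real^'l^'l \<Rightarrow> real) \<gamma>.
        monotone_on {A. psd A} loewner_le (\<le>) \<phi> \<longrightarrow>
        \<gamma> \<in> carrier_vec K \<longrightarrow> (\<forall>k<K. 0 < \<gamma> $ k) \<longrightarrow>
        strictly_feasible_NIC NT K \<sigma>2 h P \<gamma> (NT + K) \<longrightarrow>
        N_min_NIC \<phi> (bfim M \<eta> f NR NT G \<Upsilon> \<sigma>2) NT K \<sigma>2 h P \<gamma> \<le> N_bound_NIC K CARD('l))"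
proof (intro conjI ballI allI impI)
  let ?J = "bfim M \<eta> f NR NT G \<Upsilon> \<sigma>2"
  fix p
  assume "p \<in> achievable_NIC ?J NT K \<sigma>2 h P"
  then obtain V where V: "p = (?J V, vsinr_NIC K \<sigma>2 h V)" "V \<in> carrier_mat NT (NT + K)" "tx_power V \<le> P"
    by (auto simp: achievable_NIC_def)
  obtain n W where W: "K \<le> n" "n \<le> N_bound_NIC K CARD('l)" "W \<in> carrier_mat NT n" "?J W = ?J V"
    "\<And>k. k < K \<Longrightarrow> sinr_NIC K \<sigma>2 h V k \<le> sinr_NIC K \<sigma>2 h W k" "tx_power W \<le> tx_power V"
    by (rule reduce_beamformers[OF \<open>0 < \<sigma>2\<close> channels V(2) le_add2]) (assumption | rule that)+
  have "\<exists>N'. K \<le> N' \<and> N' \<le> N_bound_NIC K CARD('l) \<and> (\<exists>V' \<in> carrier_mat NT N'. ?J V' = ?J V \<and>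
      (\<forall>k<K. vsinr_NIC K \<sigma>2 h V $ k \<le> vsinr_NIC K \<sigma>2 h V' $ k) \<and> tx_power V' \<le> P)"
    using W V(3) by (intro exI[of _ n] conjI bexI[of _ W]) (simp_all add: vsinr_NIC_def)
  then show "case p of (J, \<gamma>) \<Rightarrow> (\<forall>k<K. 0 < \<gamma> $ k) \<longrightarrow>
        (\<exists>N'. K \<le> N' \<and> N' \<le> N_bound_NIC K CARD('l) \<and>
          (\<exists>V' \<in> carrier_mat NT N'. ?J V' = J \<and>
             (\<forall>k<K. \<gamma> $ k \<le> vsinr_NIC K \<sigma>2 h V' $ k) \<and> tx_power V' \<le> P))"
    unfolding V(1) by simp
next
  fix \<phi> :: "real^'l^'l \<Rightarrow> real" and \<gamma> :: "real Matrix.vec"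
  show "N_min_NIC \<phi> (bfim M \<eta> f NR NT G \<Upsilon> \<sigma>2) NT K \<sigma>2 h P \<gamma> \<le> N_bound_NIC K CARD('l)"
    by (rule N_min_NIC_le_bound[OF \<open>0 < \<sigma>2\<close> channels])
qed

end
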